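(* Let $k\ge 1$ and let $D=(V,E)$ be a digraph with a feedback vertex set $F$ of size $|F|=k$ and maximum degree $\Delta\le 4k-3$. Then $D$ is $k$-colorable if and only if $D[N[F]]$ is $k$-colorable. Furthermore, a $k$-coloring of $D[N[F]]$ can be extended to a $k$-coloring of $D$ in polynomial time.
   Context: Digraphs are loopless and have no parallel arcs, but digons (two oppositely oriented arcs between the same pair of vertices) are allowed. The degree of a vertex is its in-degree plus its out-degree. A digraph is $k$-colorable if its vertices can be colored with $k$ colors so that no color class contains a directed cycle (each color class induces an acyclic subdigraph); such a coloring is a $k$-coloring. A feedback vertex set is a set $F\subseteq V$ with $D-F$ acyclic. $N[F]$ is the closed neighborhood of $F$: $F$ together with all vertices having an arc to or from a vertex of $F$; $D[S]$ is the subdigraph induced by $S$.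
   Formalization: "Extended" is read as: from a given k-coloring of D[N[F]], a k-coloring of D is computed in polynomial time, where the given colors may be changed; keeping all the given colors on N[F] is impossible in general (already for k = 2). *)

theory Defs
  imports
    "Graph_Theory.Digraph"
    "Graph_Theory.Arc_Walk"
    "Graph_Theory.Digraph_Component"
    "HOL-Computational_Algebra.Polynomial"
begin

section \<open>Colorings and feedback vertex sets\<close>

text \<open>
  The locale \<^const>\<open>digraph\<close> describes the finite digraphs without loops and without parallel
  arcs; digons are allowed, and count as directed cycles (of length 2) for
  \<^const>\<open>pre_digraph.cycle\<close>.
\<close>

definition acyclic_digraph :: "('a, 'b) pre_digraph \<Rightarrow> bool" where
  "acyclic_digraph G \<longleftrightarrow> \<not> (\<exists>p. pre_digraph.cycle G p)"

definition vertex_degree :: "('a, 'b) pre_digraph \<Rightarrow> 'a \<Rightarrow> nat" where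
  "vertex_degree G v = in_degree G v + out_degree G v"

text \<open>Only meaningful for finite nonempty vertex sets.\<close>

definition max_degree :: "('a, 'b) pre_digraph \<Rightarrow> nat" where
  "max_degree G = Max (vertex_degree G ` verts G)"

definition is_coloring :: "nat \<Rightarrow> ('a, 'b) pre_digraph \<Rightarrow> ('a \<Rightarrow> nat) \<Rightarrow> bool" where
  "is_coloring k G c \<longleftrightarrow>
     (\<forall>v\<in>verts G. c v < k) \<and>
     (\<forall>i<k. acyclic_digraph (G \<restriction> {v \<in> verts G. c v = i}))"

definition colorable :: "nat \<Rightarrow> ('a, 'b) pre_digraph \<Rightarrow> bool" where
  "colorable k G \<longleftrightarrow> (\<exists>c. is_coloring k G c)"

definition feedback_vertex_set :: "('a, 'b) pre_digraph \<Rightarrow> 'a set \<Rightarrow> bool" where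
  "feedback_vertex_set G F \<longleftrightarrow> F \<subseteq> verts G \<and> acyclic_digraph (G \<restriction> (verts G - F))"

definition closed_nbhd :: "('a, 'b) pre_digraph \<Rightarrow> 'a set \<Rightarrow> 'a set" where
  "closed_nbhd G F = F \<union> {v \<in> verts G. \<exists>u\<in>F. u \<rightarrow>\<^bsub>G\<^esub> v \<or> v \<rightarrow>\<^bsub>G\<^esub> u}"


section \<open>Polynomial time\<close>

text \<open>
  Programs run on a random access machine whose memory consists of arrays of natural numbers, all
  of unbounded length; a program only mentions finitely many arrays, and a scalar variable is the
  cell 0 of an array. The arithmetic operations are addition and truncated subtraction, each of
  unit cost. There is deliberately no multiplication: the bit lengths of the numbers can then grow
  by at most a constant per step, so that running times on this machine and on a Turing machine are
  polynomially related.
\<close>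

datatype expr =
    Num nat
  | Cell nat expr
  | Add expr expr
  | Sub expr expr

text \<open>Conditions are expressions, read as true if their value is nonzero.\<close>

datatype prog =
    Skip
  | Store nat expr expr
  | Seq prog prog
  | Cond expr prog prog
  | Loop expr prog

type_synonym memory = "nat \<Rightarrow> nat \<Rightarrow> nat"

fun val :: "expr \<Rightarrow> memory \<Rightarrow> nat" where
  "val (Num m) s = m"
| "val (Cell a e) s = s a (val e s)"
| "val (Add e f) s = val e s + val f s"
| "val (Sub e f) s = val e s - val f s"

fun cost :: "expr \<Rightarrow> nat" where
  "cost (Num m) = 1"
| "cost (Cell a e) = 1 + cost e"
| "cost (Add e f) = 1 + cost e + cost f"
| "cost (Sub e f) = 1 + cost e + cost f"

text \<open>\<open>exec c s t s'\<close>: started in \<open>s\<close>, the program \<open>c\<close> halts after \<open>t\<close> steps in \<open>s'\<close>.\<close>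

inductive exec :: "prog \<Rightarrow> memory \<Rightarrow> nat \<Rightarrow> memory \<Rightarrow> bool" where
  exec_Skip: "exec Skip s 1 s"
| exec_Store:
    "exec (Store a e f) s (1 + cost e + cost f) (s(a := (s a)(val e s := val f s)))"
| exec_Seq:
    "exec c s t s' \<Longrightarrow> exec d s' u s'' \<Longrightarrow> exec (Seq c d) s (t + u) s''"
| exec_CondT:
    "val b s \<noteq> 0 \<Longrightarrow> exec c s t s' \<Longrightarrow> exec (Cond b c d) s (1 + cost b + t) s'"
| exec_CondF:
    "val b s = 0 \<Longrightarrow> exec d s t s' \<Longrightarrow> exec (Cond b c d) s (1 + cost b + t) s'"
| exec_LoopF:
    "val b s = 0 \<Longrightarrow> exec (Loop b c) s (1 + cost b) s"
| exec_LoopT: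
    "val b s \<noteq> 0 \<Longrightarrow> exec c s t s' \<Longrightarrow> exec (Loop b c) s' u s'' \<Longrightarrow>
     exec (Loop b c) s (1 + cost b + t + u) s''"

lemma exec_deterministic:
  "exec c s t s' \<Longrightarrow> exec c s u s'' \<Longrightarrow> u = t \<and> s'' = s'"
proof (induction arbitrary: u s'' rule: exec.induct)
  case (exec_Skip s)
  then show ?case by (cases rule: exec.cases) auto
next
  case (exec_Store a e f s)
  then show ?case by (cases rule: exec.cases) auto
next
  case (exec_Seq c s t s' d v w)
  from exec_Seq.prems obtain t1 s1 u1
    where "u = t1 + u1" "exec c s t1 s1" "exec d s1 u1 s''" by (cases rule: exec.cases) auto
  with exec_Seq.IH show ?case by metis
next
  case (exec_CondT b s c t s' d)
  from exec_CondT.prems exec_CondT.hyps obtain t1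
    where "u = 1 + cost b + t1" "exec c s t1 s''" by (cases rule: exec.cases) auto
  with exec_CondT.IH show ?case by metis
next
  case (exec_CondF b s d t s' c)
  from exec_CondF.prems exec_CondF.hyps obtain t1
    where "u = 1 + cost b + t1" "exec d s t1 s''" by (cases rule: exec.cases) auto
  with exec_CondF.IH show ?case by metis
next
  case (exec_LoopF b s c)
  from exec_LoopF.prems exec_LoopF.hyps show ?case by (cases rule: exec.cases) auto
next
  case (exec_LoopT b s c t s' v w)
  from exec_LoopT.prems exec_LoopT.hyps obtain t1 s1 u1
    where "u = 1 + cost b + t1 + u1" "exec c s t1 s1" "exec (Loop b c) s1 u1 s''"
    by (cases rule: exec.cases) auto
  with exec_LoopT.IH show ?case by metis
qed

text \<open>
  A word is stored in the array 0 and its length in the cell 0 of the array 1; this holds for the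
  input before and for the output after the computation.
\<close>

definition load :: "nat list \<Rightarrow> memory" where
  "load xs = (\<lambda>a i.
     if a = 0 \<and> i < length xs then xs ! i
     else if a = 1 \<and> i = 0 then length xs
     else 0)"

definition result :: "memory \<Rightarrow> nat list" where
  "result s = map (s 0) [0..<s 1 0]"

text \<open>
  A search problem is given by a set \<open>I\<close> of instances, an encoding of the instances as words and a
  relation \<open>sol\<close> between instances and acceptable output words. One program has to solve all
  instances, within a number of steps bounded by one polynomial in the length of the input word.
\<close>

definition polytime_solvable ::
  "'i set \<Rightarrow> ('i \<Rightarrow> nat list) \<Rightarrow> ('i \<Rightarrow> nat list \<Rightarrow> bool) \<Rightarrow> bool" where
  "polytime_solvable I encode sol \<longleftrightarrow>
     (\<exists>(c :: prog) (p :: nat poly). \<forall>x\<in>I. \<exists>t s.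
        exec c (load (encode x)) t s \<and>
        t \<le> poly p (length (encode x)) \<and>
        sol x (result s))"

text \<open>
  The encoding of a digraph with vertices \<open>0, \<dots>, n - 1\<close>, a set \<open>F\<close> of vertices and a coloring \<open>c\<close> of
  the subdigraph induced by the closed neighborhood of \<open>F\<close>: the numbers \<open>n\<close> and \<open>k\<close>, the adjacency
  matrix row by row, the characteristic vector of \<open>F\<close>, and the colors shifted by one, where 0 marks
  the vertices that are not colored. The values of \<open>c\<close> at these vertices do not enter.
\<close>

fun encode_instance ::
  "nat \<times> nat \<times> (nat, 'b) pre_digraph \<times> nat set \<times> (nat \<Rightarrow> nat) \<Rightarrow> nat list" where
  "encode_instance (n, k, D, F, c) =
     [n, k] @
     concat (map (\<lambda>u. map (\<lambda>v. if u \<rightarrow>\<^bsub>D\<^esub> v then 1 else 0) [0..<n]) [0..<n]) @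
     map (\<lambda>v. if v \<in> F then 1 else 0) [0..<n] @
     map (\<lambda>v. if v \<in> closed_nbhd D F then Suc (c v) else 0) [0..<n]"

text \<open>
  To extend a \<open>k\<close>-coloring of the subdigraph induced by the closed neighborhood of \<open>F\<close> to the whole
  digraph means to find a \<open>k\<close>-coloring of the whole digraph from it; the given colors may be changed.
  It would be false that the given colors can always be kept: for \<open>k = 2\<close> take the
  vertices \<open>f\<^sub>i, a\<^sub>i, b\<^sub>i\<close> (\<open>i = 1, 2\<close>) and \<open>u\<close>, the arcs from \<open>f\<^sub>i\<close> to \<open>a\<^sub>i\<close>, from \<open>a\<^sub>i\<close> to \<open>u\<close>,
  from \<open>u\<close> to \<open>b\<^sub>i\<close> and from \<open>b\<^sub>i\<close> to \<open>f\<^sub>i\<close>, the set \<open>F = {f\<^sub>1, f\<^sub>2}\<close>, and the coloring giving \<open>f\<^sub>i\<close>,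
  \<open>a\<^sub>i\<close>, \<open>b\<^sub>i\<close> the color \<open>i\<close>. All degrees are at most 4, and \<open>u\<close> closes a directed cycle in
  both colors.
\<close>

fun is_solution ::
  "nat \<times> nat \<times> (nat, 'b) pre_digraph \<times> nat set \<times> (nat \<Rightarrow> nat) \<Rightarrow> nat list \<Rightarrow> bool" where
  "is_solution (n, k, D, F, c) ys \<longleftrightarrow> (\<exists>c'. is_coloring k D c' \<and> ys = map c' [0..<n])"

end

theory Submission
  imports Defs
begin

text \<open>
  If some arc \<open>u \<rightarrow> v\<close> is missing between distinct vertices of \<open>F\<close>, then \<open>u\<close> and \<open>v\<close> can share a
  color, and the color saved in this way is given to the acyclic rest of the digraph.

  Otherwise \<open>F\<close> is a complete digraph, so the given coloring \<open>c\<close> uses every color exactly once on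
  \<open>F\<close>, and by the degree bound each \<open>f \<in> F\<close> has fewer than \<open>k\<close> in-neighbors or fewer than \<open>k\<close>
  out-neighbors outside \<open>F\<close>; let these be its cut. A color class meeting \<open>F\<close> only in \<open>f\<close> and avoiding
  the cut of \<open>f\<close> is acyclic. Starting with \<open>B = {}\<close>, as long as some vertex \<open>v \<notin> F\<close> lies in the cuts
  of all \<open>f \<in> F\<close> with \<open>c f \<notin> B\<close>, put \<open>c v\<close> into the set \<open>B\<close> of blocked colors. The vertices \<open>v\<close> used
  for this all lie in the cut of each \<open>f\<close> that is still unblocked, hence there are fewer than \<open>k\<close> of
  them and \<open>B\<close> never contains all the colors. At the end, vertices in all unblocked cuts
  keep their color, which is blocked, and every other vertex takes an unblocked color whose cut avoids
  it. A blocked class is then part of a class of \<open>c\<close>, and an unblocked class avoids its cut.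
\<close>

section \<open>Acyclic colorings of digraphs\<close>

text \<open>Cycles in the sense of \<open>cycle\<close> repeat no vertex, but every nonempty closed
  walk contains one, so excluding them excludes all closed walks.\<close>

lemma (in wf_digraph) acyclic_digraph_iff: "acyclic_digraph G \<longleftrightarrow> acyclic (arcs_ends G)"
proof -
  have "(\<exists>p. cycle p) \<longleftrightarrow> (\<exists>u. u \<rightarrow>\<^sup>+ u)"
  proof
    assume "\<exists>p. cycle p"
    then show "\<exists>u. u \<rightarrow>\<^sup>+ u"
      unfolding cycle_def reachable1_awalk by blast
  next
    assume "\<exists>u. u \<rightarrow>\<^sup>+ u"
    then have "\<exists>p. closed_w p"
      unfolding closed_w_def reachable1_awalk by blast
    then show "\<exists>p. cycle p"
      using closed_w_imp_cycle by blast
  qed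
  then show ?thesis
    by (auto simp: acyclic_digraph_def acyclic_def)
qed

lemma arcs_ends_induce_subgraph: "arcs_ends (G \<restriction> S) = Restr (arcs_ends G) S"
  by (auto simp: arcs_ends_conv)

lemma (in wf_digraph) acyclic_induce_subgraph_iff:
  "acyclic_digraph (G \<restriction> S) \<longleftrightarrow> acyclic (Restr (arcs_ends G) S)"
  using wf_digraph.acyclic_digraph_iff[OF wellformed_induce_subgraph]
  by (simp add: arcs_ends_induce_subgraph)

text \<open>Colorings are moved to bare relations: acyclicity then speaks of transitive closures,
  and passing to an induced subdigraph only shrinks \<open>V\<close>.\<close>

definition dicoloring :: "nat \<Rightarrow> 'a rel \<Rightarrow> 'a set \<Rightarrow> ('a \<Rightarrow> nat) \<Rightarrow> bool" where
  "dicoloring k E V c \<longleftrightarrow>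
     (\<forall>v\<in>V. c v < k) \<and> (\<forall>i<k. acyclic (Restr E {v \<in> V. c v = i}))"

lemma (in wf_digraph) is_coloring_induce_subgraph_iff:
  "is_coloring k (G \<restriction> S) c \<longleftrightarrow> dicoloring k (arcs_ends G) S c"
proof -
  have "acyclic_digraph ((G \<restriction> S) \<restriction> {v \<in> S. c v = i}) \<longleftrightarrow>
      acyclic (Restr (arcs_ends G) {v \<in> S. c v = i})" for i
  proof -
    have "Restr (Restr (arcs_ends G) S) {v \<in> S. c v = i} = Restr (arcs_ends G) {v \<in> S. c v = i}"
      by auto
    then show ?thesis
      using wf_digraph.acyclic_induce_subgraph_iff[OF wellformed_induce_subgraph,
          of S "{v \<in> S. c v = i}"]
      by (simp add: arcs_ends_induce_subgraph)
  qed
  then show ?thesis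
    by (simp add: is_coloring_def dicoloring_def)
qed

lemma (in wf_digraph) is_coloring_iff:
  "is_coloring k G c \<longleftrightarrow> dicoloring k (arcs_ends G) (verts G) c"
  by (simp add: is_coloring_def dicoloring_def acyclic_induce_subgraph_iff)

lemma dicoloring_subset:
  assumes "dicoloring k E V c" "S \<subseteq> V"
  shows "dicoloring k E S c"
  using assms unfolding dicoloring_def
  by (auto elim!: acyclic_subset)

text \<open>A closed walk can neither enter a source nor leave a sink, so it avoids \<open>f\<close>
  and stays inside \<open>A\<close>. Letting \<open>u\<close> range over \<open>insert f A\<close>
  also excludes a loop at \<open>f\<close>.\<close>

lemma acyclic_Restr_insert:
  assumes acyc: "acyclic (Restr E A)"
    and source_or_sink: "(\<forall>u\<in>insert f A. (u, f) \<notin> E) \<or> (\<forall>u\<in>insert f A. (f, u) \<notin> E)"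
  shows "acyclic (Restr E (insert f A))"
proof (rule acyclicI, rule allI)
  fix x
  let ?R = "Restr E (insert f A)"
  show "(x, x) \<notin> ?R\<^sup>+"
  proof
    assume cyc: "(x, x) \<in> ?R\<^sup>+"
    from source_or_sink show False
    proof
      assume source: "\<forall>u\<in>insert f A. (u, f) \<notin> E"
      \<comment> \<open>A walk that starts away from the source never reaches it.\<close>
      have "(a, b) \<in> ?R\<^sup>+ \<Longrightarrow> a \<noteq> f \<Longrightarrow> (a, b) \<in> (Restr E A)\<^sup>+ \<and> b \<noteq> f" for a b
      proof (induction rule: trancl_induct)
        case (base y)
        with source show ?case by auto
      next
        case (step y z)
        with source have "(y, z) \<in> Restr E A" "z \<noteq> f" by auto
        with step show ?case by (meson trancl_into_trancl)
      qed
      moreover have "x \<noteq> f"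
        using cyc source by (metis IntE SigmaE2 tranclE)
      ultimately show False
        using cyc acyc by (auto simp: acyclic_def)
    next
      assume sink: "\<forall>u\<in>insert f A. (f, u) \<notin> E"
      have "(a, b) \<in> ?R\<^sup>+ \<Longrightarrow> b \<noteq> f \<Longrightarrow> (a, b) \<in> (Restr E A)\<^sup>+ \<and> a \<noteq> f" for a b
      proof (induction rule: converse_trancl_induct)
        case (base y)
        with sink show ?case by auto
      next
        case (step y z)
        with sink have "(y, z) \<in> Restr E A" "y \<noteq> f" by auto
        with step show ?case by (meson trancl_into_trancl2)
      qed
      moreover have "x \<noteq> f"
        using cyc sink by (metis IntE SigmaE2 converse_tranclE)
      ultimately show False
        using cyc acyc by (auto simp: acyclic_def)
    qed
  qed
qed

lemma acyclic_Restr_singleton: "(a, a) \<notin> E \<Longrightarrow> acyclic (Restr E {a})"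
  using acyclic_Restr_insert[of E "{}" a] by (simp add: acyclic_def)

section \<open>Digraphs with a feedback vertex set\<close>

locale fvs_digraph =
  fixes V F :: "'a set" and E :: "'a rel" and k :: nat
  assumes finite_V: "finite V"
    and arcs_in_V: "E \<subseteq> V \<times> V"
    and no_loop: "(v, v) \<notin> E"
    and F_subset: "F \<subseteq> V"
    and acyclic_outside: "acyclic (Restr E (V - F))"
    and card_F: "card F = k"
begin

lemma finite_F: "finite F"
  using F_subset finite_V finite_subset by blast

text \<open>Once \<open>v\<close> has taken the color of \<open>u\<close>, no vertex of
  \<open>F\<close> has the color \<open>r v\<close>, so all of \<open>V - F\<close> can have it.
  Every class then lies inside \<open>V - F\<close>, inside the pair \<open>{v, u}\<close>, or has
  at most one vertex.\<close>

lemma dicoloring_of_missing_arc: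
  assumes uv: "u \<in> F" "v \<in> F" "u \<noteq> v" "(u, v) \<notin> E"
    and r: "inj_on r F" "r ` F \<subseteq> {..<k}"
  shows "dicoloring k E V (\<lambda>w. if w \<in> F then if w = v then r u else r w else r v)"
    (is "dicoloring k E V ?c")
  unfolding dicoloring_def
proof (intro conjI ballI allI impI)
  show "?c w < k" if "w \<in> V" for w
    using that uv r by auto
next
  fix i
  have other: "r w \<noteq> r v" if "w \<in> F" "w \<noteq> v" for w
    using r(1) uv(2) that by (auto dest: inj_onD)
  consider "i = r v" | "i = r u" "r u \<noteq> r v" | "i \<noteq> r v" "i \<noteq> r u" by blast
  then show "acyclic (Restr E {w \<in> V. ?c w = i})"
  proof cases
    case 1
    then have "{w \<in> V. ?c w = i} \<subseteq> V - F"
      using other uv by auto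
    then show ?thesis
      by (intro acyclic_subset[OF acyclic_outside]) auto
  next
    case 2
    have "{w \<in> V. ?c w = i} \<subseteq> {v, u}"
      using 2 r(1) uv by (auto dest: inj_onD split: if_splits)
    then have "Restr E {w \<in> V. ?c w = i} \<subseteq> Restr E {v, u}"
      by blast
    \<comment> \<open>Without the arc \<open>(u, v)\<close>, the vertex \<open>v\<close> is a source
      of the pair.\<close>
    moreover have "acyclic (Restr E {v, u})"
      using uv no_loop by (intro acyclic_Restr_insert acyclic_Restr_singleton) auto
    ultimately show ?thesis
      by (rule acyclic_subset[rotated])
  next
    case 3
    then have *: "w \<in> F \<and> r w = i" if "w \<in> {w \<in> V. ?c w = i}" for w
      using that by (auto split: if_splits)
    have "x = y" if "x \<in> {w \<in> V. ?c w = i}" "y \<in> {w \<in> V. ?c w = i}" for x y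
      using inj_onD[OF r(1), of x y] *[OF that(1)] *[OF that(2)] by simp
    then have "Restr E {w \<in> V. ?c w = i} = {}"
      using no_loop by blast
    then show ?thesis by (simp add: acyclic_def)
  qed
qed

end

section \<open>The case of a complete feedback vertex set\<close>

locale complete_fvs = fvs_digraph +
  fixes c :: "'a \<Rightarrow> nat"
  assumes complete: "u \<in> F \<Longrightarrow> v \<in> F \<Longrightarrow> u \<noteq> v \<Longrightarrow> (u, v) \<in> E"
    and k_pos: "k \<ge> 1"
    and degree: "f \<in> F \<Longrightarrow> card (E\<inverse> `` {f}) + card (E `` {f}) \<le> 4 * k - 3"
    and nbhd_coloring: "dicoloring k E (F \<union> E `` F \<union> E\<inverse> `` F) c"
begin

text \<open>A class that avoids the chosen side has \<open>f\<close> as a source or a sink. The rest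
  of \<open>F\<close> is left out because it has other colors than \<open>f\<close>.\<close>

definition cut_nbhd :: "'a \<Rightarrow> 'a set" where
  "cut_nbhd f = (if card (E\<inverse> `` {f}) \<le> card (E `` {f}) then E\<inverse> `` {f} else E `` {f}) - F"

lemma cut_subset: "f \<in> F \<Longrightarrow> cut_nbhd f \<subseteq> E `` F \<union> E\<inverse> `` F"
  by (auto simp: cut_nbhd_def)

lemma finite_nbhd: "finite (E `` A)" "finite (E\<inverse> `` A)"
  using arcs_in_V finite_V by (auto intro: finite_subset[where B = V])

lemma finite_cut: "finite (cut_nbhd f)"
  using finite_nbhd by (simp add: cut_nbhd_def)

text \<open>The smaller of two numbers with sum at most \<open>4 * k - 3\<close> is at most
  \<open>2 * k - 2\<close>. By completeness, \<open>k - 1\<close> of these neighbors are the rest of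
  \<open>F\<close>, so at most \<open>k - 1\<close> remain.\<close>

lemma card_cut:
  assumes "f \<in> F"
  shows "card (cut_nbhd f) < k"
proof -
  define N where "N = (if card (E\<inverse> `` {f}) \<le> card (E `` {f}) then E\<inverse> `` {f} else E `` {f})"
  have "card N \<le> 2 * k - 2"
    using degree[OF assms] by (auto simp: N_def)
  moreover have "F - {f} \<subseteq> N"
    using complete assms by (auto simp: N_def)
  moreover have "cut_nbhd f \<subseteq> N - (F - {f})"
    by (auto simp: cut_nbhd_def N_def)
  moreover have "finite N"
    using finite_nbhd by (simp add: N_def)
  ultimately have "card (cut_nbhd f) \<le> card N - card (F - {f})" "card N \<le> 2 * k - 2"
    by (auto simp: card_Diff_subset[symmetric] finite_F intro: card_mono)
  moreover have "card (F - {f}) = k - 1"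
    using assms finite_F card_F by simp
  ultimately show ?thesis
    using k_pos by linarith
qed

text \<open>Two vertices of \<open>F\<close> form a digon, which is a directed cycle if they share a
  color.\<close>

lemma inj_on_c: "inj_on c F"
proof (rule inj_onI, rule ccontr)
  fix u v
  assume uv: "u \<in> F" "v \<in> F" "c u = c v" "u \<noteq> v"
  let ?R = "Restr E {w \<in> F \<union> E `` F \<union> E\<inverse> `` F. c w = c u}"
  have "(u, v) \<in> ?R" "(v, u) \<in> ?R"
    using uv complete by auto
  then have "(u, u) \<in> ?R\<^sup>+" by (meson r_into_trancl trancl_into_trancl)
  moreover have "acyclic ?R"
    using nbhd_coloring uv(1) unfolding dicoloring_def by blast
  ultimately show False
    by (auto simp: acyclic_def)
qed

lemma c_image_F: "c ` F = {..<k}"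
proof (rule card_subset_eq)
  show "c ` F \<subseteq> {..<k}"
    using nbhd_coloring by (auto simp: dicoloring_def)
qed (simp_all add: card_image[OF inj_on_c] card_F)

lemma acyclic_insert_avoiding_cut:
  assumes "f \<in> F" "A \<subseteq> V - F" "A \<inter> cut_nbhd f = {}"
  shows "acyclic (Restr E (insert f A))"
proof (rule acyclic_Restr_insert)
  show "acyclic (Restr E A)"
    using assms(2) by (intro acyclic_subset[OF acyclic_outside]) auto
  show "(\<forall>u\<in>insert f A. (u, f) \<notin> E) \<or> (\<forall>u\<in>insert f A. (f, u) \<notin> E)"
    using assms no_loop by (auto simp: cut_nbhd_def split: if_splits)
qed

text \<open>The invariant of the blocking procedure, with the order of its steps forgotten:
  \<open>X\<close> collects the vertices whose colors were blocked.\<close>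

definition blockable :: "nat set \<Rightarrow> bool" where
  "blockable B \<longleftrightarrow> B \<subset> {..<k} \<and>
     (\<exists>X. B = c ` X \<and> (\<forall>f\<in>F. c f \<notin> B \<longrightarrow> X \<subseteq> cut_nbhd f))"

text \<open>These are the vertices of \<open>F\<close> whose colors may be given to
  \<open>v\<close>. If there are none, \<open>v\<close> lies in every unblocked cut and forces its
  own color to be blocked.\<close>

definition free :: "nat set \<Rightarrow> 'a \<Rightarrow> 'a set" where
  "free B v = {f \<in> F. c f \<notin> B \<and> v \<notin> cut_nbhd f}"

lemma blockable_empty: "blockable {}"
proof -
  have "{} \<noteq> {..<k}"
    using k_pos by (metis lessThan_iff empty_iff less_le_trans less_one)
  then show ?thesis
    by (auto simp: blockable_def intro!: exI[of _ "{}"])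
qed

lemma blockable_obtain_unblocked:
  assumes "blockable B"
  obtains f where "f \<in> F" "c f \<notin> B"
  using assms c_image_F unfolding blockable_def by (metis imageE psubset_imp_ex_mem DiffD1 DiffD2 psubsetE subsetI)

text \<open>Some color is still unblocked, and \<open>v\<close> lies in the corresponding cut. This
  ensures that \<open>c v\<close> is one of the given colors, as \<open>c\<close> is a coloring only
  near \<open>F\<close>.\<close>

lemma blockable_stuck_nbhd:
  assumes "blockable B" "free B v = {}"
  shows "v \<in> E `` F \<union> E\<inverse> `` F"
proof -
  obtain f where "f \<in> F" "c f \<notin> B"
    using assms(1) by (rule blockable_obtain_unblocked)
  then have "v \<in> cut_nbhd f"
    using assms(2) by (auto simp: free_def)
  then show ?thesis
    using cut_subset \<open>f \<in> F\<close> by blast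
qed

text \<open>The old witnesses and \<open>v\<close> all lie in the cut of one unblocked
  \<open>f\<close>, which has fewer than \<open>k\<close> vertices, so their colors cannot exhaust
  all \<open>k\<close>.\<close>

lemma blockable_insert:
  assumes "blockable B" "free B v = {}"
  shows "blockable (insert (c v) B)"
proof -
  obtain X where X: "B = c ` X" "\<And>f. f \<in> F \<Longrightarrow> c f \<notin> B \<Longrightarrow> X \<subseteq> cut_nbhd f"
    using assms(1) unfolding blockable_def by blast
  have stuck: "v \<in> cut_nbhd f" if "f \<in> F" "c f \<notin> B" for f
    using assms(2) that by (auto simp: free_def)
  obtain f where f: "f \<in> F" "c f \<notin> B"
    using assms(1) by (rule blockable_obtain_unblocked)
  have sub: "insert v X \<subseteq> cut_nbhd f"
    using X(2)[OF f] stuck[OF f] by simp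
  then have "card (insert (c v) B) \<le> card (insert v X)"
    unfolding X(1) using finite_cut[of f]
    by (metis card_image_le finite_subset image_insert)
  also have "\<dots> \<le> card (cut_nbhd f)"
    using sub finite_cut by (rule card_mono[rotated])
  also have "\<dots> < k"
    using f(1) by (rule card_cut)
  finally have "insert (c v) B \<noteq> {..<k}"
    by (metis card_lessThan less_irrefl)
  moreover have "insert (c v) B \<subseteq> {..<k}"
    using assms nbhd_coloring blockable_stuck_nbhd[OF assms]
    unfolding blockable_def dicoloring_def by blast
  ultimately show ?thesis
    unfolding blockable_def using X stuck
    by (intro conjI psubsetI exI[of _ "insert v X"]) auto
qed

text \<open>The choice among the free colors is left open, so that this applies both to a maximal
  blockable set and to the colors that the program finds.\<close>

lemma dicoloring_of_closed_block:
  assumes B: "blockable B"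
    and closed: "\<And>v. v \<in> V - F \<Longrightarrow> free B v = {} \<Longrightarrow> c v \<in> B"
    and on_F: "\<And>f. f \<in> F \<Longrightarrow> c' f = c f"
    and free: "\<And>v. v \<in> V - F \<Longrightarrow> free B v \<noteq> {} \<Longrightarrow> c' v \<in> c ` free B v"
    and stuck: "\<And>v. v \<in> V - F \<Longrightarrow> free B v = {} \<Longrightarrow> c' v = c v"
  shows "dicoloring k E V c'"
  unfolding dicoloring_def
proof (intro conjI ballI allI impI)
  fix v assume v: "v \<in> V"
  have "B \<subseteq> {..<k}"
    using B by (auto simp: blockable_def)
  then show "c' v < k"
    using v on_F[of v] free[of v] stuck[of v] closed[of v] c_image_F
    by (cases "v \<in> F"; cases "free B v = {}") (auto simp: free_def)
next
  fix i assume "i < k"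
  then obtain f where f: "f \<in> F" "c f = i"
    using c_image_F by (metis imageE lessThan_iff)
  \<comment> \<open>As \<open>c\<close> is injective on \<open>F\<close>, each class contains
    exactly one vertex of \<open>F\<close>.\<close>
  have color_class: "{v \<in> V. c' v = i} = insert f {v \<in> V - F. c' v = i}"
    using f F_subset on_F inj_on_c by (auto dest: inj_onD)
  show "acyclic (Restr E {v \<in> V. c' v = i})"
  proof (cases "i \<in> B")
    case True
    \<comment> \<open>A vertex with a free color takes an unblocked one, so outside \<open>F\<close>
      a blocked class has only stuck vertices, which keep their color under
      \<open>c\<close>.\<close>
    have "v \<in> E `` F \<union> E\<inverse> `` F \<and> c v = i" if v: "v \<in> V - F" "c' v = i" for v
    proof -
      have "free B v = {}"
      proof (rule ccontr)
        assume "free B v \<noteq> {}"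
        then obtain g where "g \<in> free B v" "c' v = c g"
          using free[OF v(1)] by blast
        then show False
          using v(2) True by (simp add: free_def)
      qed
      then show ?thesis
        using stuck[OF v(1)] blockable_stuck_nbhd[OF B] v(2) by auto
    qed
    then have "{v \<in> V. c' v = i} \<subseteq> {v \<in> F \<union> E `` F \<union> E\<inverse> `` F. c v = i}"
      unfolding color_class using f by auto
    then have "Restr E {v \<in> V. c' v = i} \<subseteq> Restr E {v \<in> F \<union> E `` F \<union> E\<inverse> `` F. c v = i}"
      by blast
    moreover have "acyclic (Restr E {v \<in> F \<union> E `` F \<union> E\<inverse> `` F. c v = i})"
      using nbhd_coloring \<open>i < k\<close> by (auto simp: dicoloring_def)
    ultimately show ?thesis
      by (rule acyclic_subset[rotated])
  next
    case False
    \<comment> \<open>A stuck vertex would have a blocked color. Otherwise the color comes from a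
      free \<open>g\<close>, and injectivity of \<open>c\<close> gives \<open>g = f\<close>.\<close>
    have "v \<notin> cut_nbhd f" if v: "v \<in> V - F" "c' v = i" for v
    proof (cases "free B v = {}")
      case True
      then show ?thesis
        using closed stuck v False by auto
    next
      case nonempty: False
      obtain g where "g \<in> free B v" "c g = i"
        using free[OF v(1) nonempty] v(2) by auto
      then show ?thesis
        using f inj_on_c by (auto simp: free_def dest: inj_onD)
    qed
    then show ?thesis
      unfolding color_class using f(1) by (intro acyclic_insert_avoiding_cut) auto
  qed
qed

lemma dicoloring_exists: "\<exists>c'. dicoloring k E V c'"
proof -
  have "finite {B. blockable B}"
    by (rule finite_subset[of _ "Pow {..<k}"]) (auto simp: blockable_def)
  then obtain B where B: "blockable B" and max: "\<And>B'. blockable B' \<Longrightarrow> B \<subseteq> B' \<Longrightarrow> B' = B"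
    using finite_has_maximal[of "{B. blockable B}"] blockable_empty by blast
  \<comment> \<open>Otherwise \<open>insert (c v) B\<close> would be a larger blockable set.\<close>
  have "c v \<in> B" if "free B v = {}" for v
    using max[OF blockable_insert[OF B that]] by auto
  then show ?thesis
    using B
    by (intro exI[of _ "\<lambda>v. if v \<in> F \<or> free B v = {} then c v else c (SOME f. f \<in> free B v)"]
        dicoloring_of_closed_block[of B]) (auto simp: some_in_eq)
qed

end

section \<open>Transfer to digraphs: degrees, neighborhoods and the equivalence\<close>

lemma (in nomulti_digraph) in_degree_eq_card: "in_degree G v = card ((arcs_ends G)\<inverse> `` {v})"
proof -
  \<comment> \<open>Without parallel arcs, an arc into \<open>v\<close> is determined by its
    tail.\<close>
  have "inj_on (tail G) (in_arcs G v)"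
    using inj_on_arc_to_ends by (auto simp: inj_on_def arc_to_ends_def)
  moreover have "tail G ` in_arcs G v = (arcs_ends G)\<inverse> `` {v}"
    by (auto simp: arcs_ends_conv)
  ultimately show ?thesis
    unfolding in_degree_def by (metis card_image)
qed

lemma (in nomulti_digraph) out_degree_eq_card: "out_degree G v = card (arcs_ends G `` {v})"
proof -
  have "inj_on (head G) (out_arcs G v)"
    using inj_on_arc_to_ends by (auto simp: inj_on_def arc_to_ends_def)
  moreover have "head G ` out_arcs G v = arcs_ends G `` {v}"
    by (auto simp: arcs_ends_conv)
  ultimately show ?thesis
    unfolding out_degree_def by (metis card_image)
qed

lemma (in digraph) card_nbhds_le_max_degree:
  assumes "v \<in> verts G"
  shows "card ((arcs_ends G)\<inverse> `` {v}) + card (arcs_ends G `` {v}) \<le> max_degree G"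
proof -
  have "vertex_degree G v \<le> max_degree G"
    unfolding max_degree_def using assms by (intro Max_ge) auto
  then show ?thesis
    by (simp add: vertex_degree_def in_degree_eq_card out_degree_eq_card)
qed

lemma (in wf_digraph) closed_nbhd_eq:
  "closed_nbhd G F = F \<union> arcs_ends G `` F \<union> (arcs_ends G)\<inverse> `` F"
  using adj_in_verts by (auto simp: closed_nbhd_def)

lemma (in digraph) fvs_digraphI:
  assumes "feedback_vertex_set G F" "card F = k"
  shows "fvs_digraph (verts G) F (arcs_ends G) k"
  using assms adj_in_verts adj_not_same
  by unfold_locales (auto simp: feedback_vertex_set_def acyclic_induce_subgraph_iff)

lemma (in digraph) complete_fvsI:
  assumes "feedback_vertex_set G F" "card F = k" "k \<ge> 1" "max_degree G \<le> 4 * k - 3"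
    and "is_coloring k (G \<restriction> closed_nbhd G F) c"
    and "\<And>u v. u \<in> F \<Longrightarrow> v \<in> F \<Longrightarrow> u \<noteq> v \<Longrightarrow> u \<rightarrow> v"
  shows "complete_fvs (verts G) F (arcs_ends G) k c"
proof -
  interpret fvs_digraph "verts G" F "arcs_ends G" k
    using assms by (intro fvs_digraphI)
  show ?thesis
  proof
    show "card ((arcs_ends G)\<inverse> `` {f}) + card (arcs_ends G `` {f}) \<le> 4 * k - 3"
      if "f \<in> F" for f
      using card_nbhds_le_max_degree[of f] assms(4) that F_subset by auto
    show "dicoloring k (arcs_ends G) (F \<union> arcs_ends G `` F \<union> (arcs_ends G)\<inverse> `` F) c"
      using assms(5) by (simp add: is_coloring_induce_subgraph_iff closed_nbhd_eq)
  qed (use assms in auto)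
qed

lemma (in digraph) colorable_iff_closed_nbhd:
  assumes "k \<ge> 1" "feedback_vertex_set G F" "card F = k" "max_degree G \<le> 4 * k - 3"
  shows "colorable k G \<longleftrightarrow> colorable k (G \<restriction> closed_nbhd G F)"
proof
  assume "colorable k G"
  then obtain c where "dicoloring k (arcs_ends G) (verts G) c"
    by (auto simp: colorable_def is_coloring_iff)
  moreover have "closed_nbhd G F \<subseteq> verts G"
    using assms(2) by (auto simp: closed_nbhd_def feedback_vertex_set_def)
  ultimately show "colorable k (G \<restriction> closed_nbhd G F)"
    unfolding colorable_def is_coloring_induce_subgraph_iff
    by (blast intro: dicoloring_subset)
next
  assume "colorable k (G \<restriction> closed_nbhd G F)"
  then obtain c where c: "is_coloring k (G \<restriction> closed_nbhd G F) c"
    by (auto simp: colorable_def)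
  interpret fvs_digraph "verts G" F "arcs_ends G" k
    using assms by (intro fvs_digraphI)
  have "\<exists>c'. dicoloring k (arcs_ends G) (verts G) c'"
  proof (cases "\<forall>u\<in>F. \<forall>v\<in>F. u \<noteq> v \<longrightarrow> u \<rightarrow> v")
    case True
    then interpret complete_fvs "verts G" F "arcs_ends G" k c
      using assms c by (intro complete_fvsI) auto
    show ?thesis
      by (rule dicoloring_exists)
  next
    case False
    obtain r where "bij_betw r F {..<k}"
      using finite_F card_F ex_bij_betw_finite_nat[of F] by (auto simp: atLeast0LessThan)
    then show ?thesis
      using False dicoloring_of_missing_arc[of _ _ r] by (auto simp: bij_betw_def)
  qed
  then show "colorable k G"
    by (simp add: colorable_def is_coloring_iff)
qed

section \<open>Total correctness with time bounds\<close>

text \<open>\<open>T\<close> is only an upper bound, so that budgets can be rounded up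
  generously.\<close>

definition run :: "prog \<Rightarrow> memory \<Rightarrow> nat \<Rightarrow> (memory \<Rightarrow> bool) \<Rightarrow> bool" where
  "run p s T Q \<longleftrightarrow> (\<exists>t s'. exec p s t s' \<and> t \<le> T \<and> Q s')"

inductive_cases exec_SkipE: "exec Skip s t s'"
inductive_cases exec_StoreE: "exec (Store a e f) s t s'"
inductive_cases exec_SeqE: "exec (Seq p q) s t s'"
inductive_cases exec_CondE: "exec (Cond b p q) s t s'"

lemma run_mono:
  assumes "run p s T Q" "T \<le> U" "\<And>s'. Q s' \<Longrightarrow> R s'"
  shows "run p s U R"
  using assms unfolding run_def by (meson le_trans)

text \<open>This and the next rules are equivalences, so that simplification executes straight-line
  code symbolically and subtracts the steps from the budget.\<close>

lemma run_Skip [simp]: "run Skip s T Q \<longleftrightarrow> 1 \<le> T \<and> Q s"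
  unfolding run_def by (metis exec_Skip exec_SkipE)

lemma run_Store [simp]:
  "run (Store a e f) s T Q \<longleftrightarrow>
     1 + cost e + cost f \<le> T \<and> Q (s(a := (s a)(val e s := val f s)))"
  unfolding run_def by (metis exec_Store exec_StoreE)

lemma run_Cond [simp]:
  "run (Cond b p q) s T Q \<longleftrightarrow>
     1 + cost b \<le> T \<and> run (if val b s \<noteq> 0 then p else q) s (T - (1 + cost b)) Q"
proof
  assume "run (Cond b p q) s T Q"
  then obtain t s' where "exec (Cond b p q) s t s'" "t \<le> T" "Q s'"
    by (auto simp: run_def)
  then show "1 + cost b \<le> T \<and> run (if val b s \<noteq> 0 then p else q) s (T - (1 + cost b)) Q"
    unfolding run_def by (elim exec_CondE) (auto intro!: exI[of _ s'])
next
  assume *: "1 + cost b \<le> T \<and> run (if val b s \<noteq> 0 then p else q) s (T - (1 + cost b)) Q"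
  then obtain t s' where t: "exec (if val b s \<noteq> 0 then p else q) s t s'" "t \<le> T - (1 + cost b)" "Q s'"
    by (auto simp: run_def)
  then have "exec (Cond b p q) s (1 + cost b + t) s'"
    by (cases "val b s = 0") (auto intro: exec_CondT[simplified] exec_CondF[simplified])
  moreover have "1 + cost b + t \<le> T"
    using conjunct1[OF *] t(2) by linarith
  ultimately show "run (Cond b p q) s T Q"
    unfolding run_def using t(3) by blast
qed

lemma run_Seq:
  assumes "run p s T (\<lambda>s'. run q s' U Q)" "T + U \<le> W"
  shows "run (Seq p q) s W Q"
proof -
  obtain t s' where t: "exec p s t s'" "t \<le> T" "run q s' U Q"
    using assms(1) by (auto simp: run_def)
  then obtain u s'' where u: "exec q s' u s''" "u \<le> U" "Q s''"
    by (auto simp: run_def)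
  have "exec (Seq p q) s (t + u) s''"
    using t(1) u(1) by (rule exec_Seq)
  then show ?thesis
    unfolding run_def using assms(2) t(2) u by (meson add_mono le_trans)
qed

text \<open>A store has a known exact cost, so the budget splits without a choice, unlike in
  \<open>run_Seq\<close>.\<close>

lemma run_Seq_Store [simp]:
  "run (Seq (Store a e f) q) s T Q \<longleftrightarrow> 1 + cost e + cost f \<le> T \<and>
     run q (s(a := (s a)(val e s := val f s))) (T - (1 + cost e + cost f)) Q"
proof
  assume "run (Seq (Store a e f) q) s T Q"
  then obtain t s' where "exec (Seq (Store a e f) q) s t s'" "t \<le> T" "Q s'"
    by (auto simp: run_def)
  then show "1 + cost e + cost f \<le> T \<and>
      run q (s(a := (s a)(val e s := val f s))) (T - (1 + cost e + cost f)) Q"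
    unfolding run_def by (elim exec_SeqE exec_StoreE) (auto intro!: exI[of _ s'])
next
  assume *: "1 + cost e + cost f \<le> T \<and>
      run q (s(a := (s a)(val e s := val f s))) (T - (1 + cost e + cost f)) Q"
  then show "run (Seq (Store a e f) q) s T Q"
    by (intro run_Seq[where T = "1 + cost e + cost f" and U = "T - (1 + cost e + cost f)"]) auto
qed

text \<open>The measure \<open>V\<close> allows at most \<open>N\<close> passes; the final failing
  test is charged as one more full pass.\<close>

lemma run_Loop:
  fixes V :: "memory \<Rightarrow> nat"
  assumes "I s" "V s \<le> N"
    and body: "\<And>s. I s \<Longrightarrow> val b s \<noteq> 0 \<Longrightarrow> run p s T (\<lambda>s'. I s' \<and> V s' < V s)"
    and exit: "\<And>s. I s \<Longrightarrow> val b s = 0 \<Longrightarrow> Q s"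
    and time: "(N + 1) * (1 + cost b + T) \<le> W"
  shows "run (Loop b p) s W Q"
proof -
  have "run (Loop b p) s ((N + 1) * (1 + cost b + T)) Q" if "I s" "V s \<le> N" for s
    using that
  proof (induction N arbitrary: s)
    case (0 s)
    \<comment> \<open>The body cannot decrease a measure that is already 0, so the guard must
      fail.\<close>
    have "val b s = 0"
      using body[OF 0(1)] 0(2) by (force simp: run_def)
    then show ?case
      unfolding run_def using exit[OF 0(1)] exec_LoopF[of b s p] by fastforce
  next
    case (Suc N s)
    show ?case
    proof (cases "val b s = 0")
      case True
      then show ?thesis
        unfolding run_def using exit[OF Suc.prems(1)] exec_LoopF[of b s p] by fastforce
    next
      case False
      obtain t s' where t: "exec p s t s'" "t \<le> T" "I s'" "V s' < V s"
        using body[OF Suc.prems(1) False] by (auto simp: run_def)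
      then obtain u s'' where u: "exec (Loop b p) s' u s''"
        "u \<le> (N + 1) * (1 + cost b + T)" "Q s''"
        using Suc.IH[of s'] Suc.prems(2) by (auto simp: run_def)
      have "exec (Loop b p) s (1 + cost b + t + u) s''"
        using False t(1) u(1) by (rule exec_LoopT)
      moreover have "1 + cost b + t + u \<le> (Suc N + 1) * (1 + cost b + T)"
        using t(2) u(2) by simp
      ultimately show ?thesis
        unfolding run_def using u(3) by blast
    qed
  qed
  then show ?thesis
    using assms(1,2) time run_mono by blast
qed

abbreviation var :: "nat \<Rightarrow> expr" where
  "var a \<equiv> Cell a (Num 0)"

text \<open>The truncated difference is nonzero exactly while the counter is below the
  bound.\<close>

definition for_loop :: "nat \<Rightarrow> expr \<Rightarrow> prog \<Rightarrow> prog" where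
  "for_loop i b p = Seq (Store i (Num 0) (Num 0))
     (Loop (Sub b (var i)) (Seq p (Store i (Num 0) (Add (var i) (Num 1)))))"

text \<open>A bound \<open>A * m ^ d\<close> for the body yields one of the same shape for the loop,
  so that nested loops only add constants and raise the exponent.\<close>

lemma run_for_loop:
  assumes init: "I 0 (s(i := (s i)(0 := 0)))"
    and bound: "\<And>j s. I j s \<Longrightarrow> val b s = N"
    and body: "\<And>j s. j < N \<Longrightarrow> I j s \<Longrightarrow> s i 0 = j \<Longrightarrow>
      run p s (A * m ^ d) (\<lambda>s'. s' i 0 = j \<and> I (Suc j) (s'(i := (s' i)(0 := Suc j))))"
    and exit: "\<And>s. I N s \<Longrightarrow> Q s"
    and m: "N + 2 \<le> m"
    and time: "(A + cost b + 10) * m ^ Suc d \<le> W"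
  shows "run (for_loop i b p) s W Q"
proof -
  let ?s = "s(i := (s i)(0 := 0))"
  let ?T = "A * m ^ d + 6"
  have "run (Loop (Sub b (var i)) (Seq p (Store i (Num 0) (Add (var i) (Num 1))))) ?s
      ((N + 1) * (1 + cost (Sub b (var i)) + ?T)) Q"
  proof (rule run_Loop[where I = "\<lambda>s. I (s i 0) s \<and> s i 0 \<le> N" and V = "\<lambda>s. N - s i 0"])
    fix s
    assume s: "I (s i 0) s \<and> s i 0 \<le> N" "val (Sub b (var i)) s \<noteq> 0"
    then have less: "s i 0 < N"
      using bound[of "s i 0" s] by simp
    show "run (Seq p (Store i (Num 0) (Add (var i) (Num 1)))) s ?T
        (\<lambda>s'. (I (s' i 0) s' \<and> s' i 0 \<le> N) \<and> N - s' i 0 < N - s i 0)"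
      using s less
      by (intro run_Seq[OF run_mono[OF body[of "s i 0" s] order_refl]]) auto
  next
    fix s
    assume s: "I (s i 0) s \<and> s i 0 \<le> N" "val (Sub b (var i)) s = 0"
    then have "s i 0 = N"
      using bound[of "s i 0" s] by simp
    then show "Q s"
      using s exit by simp
  qed (use init in auto)
  \<comment> \<open>The 10 is made of \<open>cost b + 4\<close> steps for entering a pass, less
    \<open>cost b\<close>, and 6 for the increment. The 3 steps of the initialization fit into one
    extra pass, whence \<open>N + 2\<close>.\<close>
  moreover have "3 + (N + 1) * (1 + cost (Sub b (var i)) + ?T) \<le> W"
  proof -
    have "1 \<le> m ^ d"
      using m by simp
    then have "A * m ^ d + (cost b + 10) * 1 \<le> A * m ^ d + (cost b + 10) * m ^ d"
      by (intro add_mono mult_le_mono) auto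
    then have "A * m ^ d + cost b + 10 \<le> (A + cost b + 10) * m ^ d"
      by (simp add: algebra_simps)
    then have "(N + 2) * (A * m ^ d + cost b + 10) \<le> m * ((A + cost b + 10) * m ^ d)"
      using m by (intro mult_le_mono)
    also have "\<dots> \<le> W"
      using time by (simp add: algebra_simps)
    finally show ?thesis
      by (simp add: algebra_simps)
  qed
  ultimately show ?thesis
    unfolding for_loop_def
    by (simp add: run_mono)
qed

section \<open>The program\<close>

text \<open>
  The characteristic vector of \<open>F\<close> and the colors follow the adjacency matrix in the input, so they
  are read as its rows \<open>n\<close> and \<open>n + 1\<close>. Use of the arrays:
  1: \<open>n\<close>; 2: addresses of the rows; 3, 4: loop counters; 5: ranks of the vertices of \<open>F\<close>; 6: new
  colors, shifted by one; 7: blocked colors, shifted by one; 8, 9: in- and out-degrees; 10, 11, 12: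
  whether a missing arc in \<open>F\<close> was found, its tail and its head; 13: size of the part of \<open>F\<close> seen so far;
  14: whether the current pass blocked a color.
\<close>

abbreviation entry :: "expr \<Rightarrow> expr \<Rightarrow> expr" where
  "entry e f \<equiv> Cell 0 (Add (Cell 2 e) f)"

abbreviation in_F :: "expr \<Rightarrow> expr" where
  "in_F e \<equiv> entry (var 1) e"

abbreviation col :: "expr \<Rightarrow> expr" where
  "col e \<equiv> entry (Add (var 1) (Num 1)) e"

text \<open>Row addresses are summed up because the machine cannot multiply. The
  \<open>n + 1\<close> passes also reach the rows \<open>n\<close> and \<open>n + 1\<close>, which
  hold \<open>F\<close> and the colors.\<close>

definition rows_prog :: prog where
  "rows_prog =
     Seq (Store 1 (Num 0) (var 0))
    (Seq (Store 2 (Num 0) (Num 2))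
         (for_loop 3 (Add (var 1) (Num 1))
           (Store 2 (Add (var 3) (Num 1)) (Add (Cell 2 (var 3)) (var 1)))))"

definition rank_prog :: prog where
  "rank_prog =
     Seq (Store 13 (Num 0) (Num 0))
         (for_loop 3 (var 1)
           (Seq (Store 5 (var 3) (var 13))
                (Store 13 (Num 0) (Add (var 13) (in_F (var 3))))))"

text \<open>
  The operands are 0 or 1, except for the two differences of the loop counters, which both vanish
  only on the diagonal; conjunction and negation become truncated subtraction.
\<close>

definition missing_arc :: expr where
  "missing_arc = Sub (Add (in_F (var 3)) (in_F (var 4)))
     (Add (Num 1) (Add (entry (var 3) (var 4))
       (Sub (Num 1) (Add (Sub (var 3) (var 4)) (Sub (var 4) (var 3))))))"

definition search_prog :: prog where
  "search_prog =
     Seq (Store 10 (Num 0) (Num 0))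
         (for_loop 3 (var 1) (for_loop 4 (var 1)
           (Cond missing_arc
             (Seq (Store 10 (Num 0) (Num 1))
             (Seq (Store 11 (Num 0) (var 3))
                  (Store 12 (Num 0) (var 4))))
             Skip)))"

definition rank_color_prog :: prog where
  "rank_color_prog =
     Seq (for_loop 3 (var 1)
           (Cond (in_F (var 3))
             (Store 6 (var 3) (Add (Cell 5 (var 3)) (Num 1)))
             (Store 6 (var 3) (Add (Cell 5 (var 12)) (Num 1)))))
         (Store 6 (var 12) (Add (Cell 5 (var 11)) (Num 1)))"

definition degree_prog :: prog where
  "degree_prog =
     for_loop 3 (var 1) (for_loop 4 (var 1)
       (Seq (Store 8 (var 3) (Add (Cell 8 (var 3)) (entry (var 4) (var 3))))
            (Store 9 (var 3) (Add (Cell 9 (var 3)) (entry (var 3) (var 4))))))"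

text \<open>Truncation turns the degree difference into a bit, which is 1 exactly if the cut is
  taken from the out-neighbors.\<close>

definition side :: expr where
  "side = Sub (Num 1) (Sub (Num 1) (Sub (Cell 8 (var 4)) (Cell 9 (var 4))))"

text \<open>For \<open>x, y, z\<close> in \<open>{0, 1}\<close>, the term \<open>(x + y - 1) + (z - x)\<close> is \<open>if x = 1 then y else z\<close>.\<close>

definition in_cut :: expr where
  "in_cut = Add (Sub (Add side (entry (var 4) (var 3))) (Num 1)) (Sub (entry (var 3) (var 4)) side)"

text \<open>Outside \<open>F\<close> the guard is 0 by truncation, whatever is subtracted. If
  several colors are free, the last one found stays.\<close>

definition free_prog :: prog where
  "free_prog =
     for_loop 4 (var 1)
       (Cond (Sub (in_F (var 4)) (Add (Cell 7 (col (var 4))) in_cut))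
         (Store 6 (var 3) (col (var 4)))
         Skip)"

text \<open>Colors are shifted by one, so a 0 left in array 6 means that no free color was
  found.\<close>

definition block_prog :: prog where
  "block_prog =
     Cond (Cell 6 (var 3))
       Skip
       (Seq (Store 6 (var 3) (col (var 3)))
            (Cond (Cell 7 (col (var 3)))
              Skip
              (Seq (Store 7 (col (var 3)) (Num 1))
                   (Store 14 (Num 0) (Num 1)))))"

definition settle_prog :: prog where
  "settle_prog =
     Cond (in_F (var 3))
       (Store 6 (var 3) (col (var 3)))
       (Seq (Store 6 (var 3) (Num 0)) (Seq free_prog block_prog))"

definition pass_prog :: prog where
  "pass_prog = for_loop 3 (var 1) settle_prog"

text \<open>Blocking a color may invalidate choices made earlier in the same pass. Passes are
  therefore repeated until one blocks nothing, and then all its choices refer to the same blocked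
  set.\<close>

definition close_prog :: prog where
  "close_prog =
     Seq (Store 14 (Num 0) (Num 1))
         (Loop (var 14) (Seq (Store 14 (Num 0) (Num 0)) pass_prog))"

definition output_prog :: prog where
  "output_prog = for_loop 3 (var 1) (Store 0 (var 3) (Sub (Cell 6 (var 3)) (Num 1)))"

definition coloring_prog :: prog where
  "coloring_prog =
     Seq rows_prog (Seq rank_prog (Seq search_prog
    (Seq (Cond (var 10) rank_color_prog (Seq degree_prog close_prog)) output_prog)))"

section \<open>Correctness of the program\<close>

lemma card_Int_lessThan_Suc:
  "card (A \<inter> {..<Suc i}) = card (A \<inter> {..<i}) + of_bool (i \<in> A)"
  by (simp add: lessThan_Suc)

text \<open>The base \<open>m\<close> of all time bounds suits the longest counting loop, which
  makes \<open>n + 1\<close> passes and needs \<open>n + 3\<close> in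
  \<open>run_for_loop\<close>.\<close>

locale input_memory = fvs_digraph "{0..<n}" F E k for n :: nat and F E k +
  fixes c :: "nat \<Rightarrow> nat" and inp :: "nat \<Rightarrow> nat" and m :: nat
  assumes inp_n: "inp 0 = n"
    and inp_E: "u < n \<Longrightarrow> v < n \<Longrightarrow> inp (2 + u * n + v) = of_bool ((u, v) \<in> E)"
    and inp_F: "v < n \<Longrightarrow> inp (2 + n * n + v) = of_bool (v \<in> F)"
    and inp_c: "v < n \<Longrightarrow> inp (2 + Suc n * n + v) =
      (if v \<in> F \<union> E `` F \<union> E\<inverse> `` F then Suc (c v) else 0)"
    and m_eq: "m = n + 3"
begin

definition ready :: "memory \<Rightarrow> bool" where
  "ready s \<longleftrightarrow> s 0 = inp \<and> s (Suc 0) 0 = n \<and> (\<forall>u\<le>Suc n. s 2 u = 2 + u * n)"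

lemma ready_upd [simp]: "a > 2 \<Longrightarrow> ready (s(a := x)) = ready s"
  by (auto simp: ready_def)

lemma ready_n [simp]: "ready s \<Longrightarrow> s (Suc 0) 0 = n"
  by (simp add: ready_def)

lemma ready_E [simp]:
  "ready s \<Longrightarrow> u < n \<Longrightarrow> v < n \<Longrightarrow> s 0 (s 2 u + v) = of_bool ((u, v) \<in> E)"
  using inp_E by (simp add: ready_def)

lemma ready_F [simp]: "ready s \<Longrightarrow> v < n \<Longrightarrow> s 0 (s 2 n + v) = of_bool (v \<in> F)"
  using inp_F by (simp add: ready_def)

lemma ready_c [simp]:
  "ready s \<Longrightarrow> v < n \<Longrightarrow> s 0 (s 2 (Suc n) + v) =
     (if v \<in> F \<union> E `` F \<union> E\<inverse> `` F then Suc (c v) else 0)"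
  using inp_c by (simp add: ready_def)

text \<open>These arrays are used as accumulators and flags without being initialized by the
  program.\<close>

definition clean :: "memory \<Rightarrow> bool" where
  "clean s \<longleftrightarrow> s 7 = (\<lambda>_. 0) \<and> s 8 = (\<lambda>_. 0) \<and> s 9 = (\<lambda>_. 0)"

lemma clean_upd [simp]: "a \<notin> {7, 8, 9} \<Longrightarrow> clean (s(a := x)) = clean s"
  by (auto simp: clean_def)

lemma F_less: "v \<in> F \<Longrightarrow> v < n"
  using F_subset by auto

lemma run_rows_prog:
  assumes "s 0 = inp" "clean s"
  shows "run rows_prog s (100 * m) (\<lambda>s'. ready s' \<and> clean s')"
  unfolding rows_prog_def
  apply (simp add: m_eq)
  apply (rule run_for_loop[where N = "n + 1" and A = 20 and d = 0 and m = "n + 3"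
      and I = "\<lambda>j s. s 0 = inp \<and> s (Suc 0) 0 = n \<and> clean s \<and> (\<forall>u\<le>j. s 2 u = 2 + u * n)"])
  using assms inp_n
       apply (auto simp: ready_def le_Suc_eq)
  done

definition ranked :: "memory \<Rightarrow> bool" where
  "ranked s \<longleftrightarrow> (\<forall>v<n. s 5 v = card (F \<inter> {..<v}))"

lemma ranked_upd [simp]: "a \<noteq> 5 \<Longrightarrow> ranked (s(a := x)) = ranked s"
  by (auto simp: ranked_def)

lemma run_rank_prog:
  assumes "ready s" "clean s"
  shows "run rank_prog s (100 * m) (\<lambda>s'. ready s' \<and> clean s' \<and> ranked s')"
  unfolding rank_prog_def
  apply (simp add: m_eq)
  apply (rule run_for_loop[where N = n and A = 20 and d = 0 and m = "n + 3"
      and I = "\<lambda>j s. ready s \<and> clean s \<and> s 13 0 = card (F \<inter> {..<j}) \<and>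
        (\<forall>v<j. s 5 v = card (F \<inter> {..<v}))"])
  using assms
       apply (auto simp: ranked_def less_Suc_eq card_Int_lessThan_Suc)
  done

definition missing :: "nat \<Rightarrow> nat \<Rightarrow> bool" where
  "missing u v \<longleftrightarrow> u \<in> F \<and> v \<in> F \<and> u \<noteq> v \<and> (u, v) \<notin> E"

lemma missing_less: "missing u v \<Longrightarrow> u < n \<and> v < n"
  using F_less by (simp add: missing_def)

lemma val_missing_arc [simp]:
  assumes "ready s" "s 3 0 < n" "s 4 0 < n"
  shows "val missing_arc s = of_bool (missing (s 3 0) (s 4 0))"
  using assms
  by (cases "s 3 0 \<in> F"; cases "s 4 0 \<in> F"; cases "(s 3 0, s 4 0) \<in> E")
    (auto simp: missing_arc_def missing_def)

lemma cost_missing_arc [simp]: "cost missing_arc = 39"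
  by (simp add: missing_arc_def)

lemma run_search_prog:
  assumes "ready s" "clean s" "ranked s"
  shows "run search_prog s (100 * m ^ 2) (\<lambda>s'. ready s' \<and> clean s' \<and> ranked s' \<and>
    (if s' 10 0 = 0 then \<forall>u v. \<not> missing u v else missing (s' 11 0) (s' 12 0)))"
proof -
  \<comment> \<open>\<open>P\<close> describes the pairs searched so far: complete rows for the
    outer loop, and an initial piece of row \<open>i\<close> for the inner one.\<close>
  define inv where "inv P s \<longleftrightarrow> ready s \<and> clean s \<and> ranked s \<and>
      (if s 10 0 = 0 then \<forall>u<n. \<forall>v<n. P u v \<longrightarrow> \<not> missing u v
       else missing (s 11 0) (s 12 0))" for P and s :: memory
  have inv_upd: "inv P (s(a := x)) = inv P s" if "a = 3 \<or> a = 4" for P s a x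
    using that by (auto simp: inv_def)
  have m: "m \<ge> 3" "9 \<le> m * m"
    using m_eq mult_le_mono[of 3 m 3 m] by auto
  \<comment> \<open>The factor 72 is \<open>60 + 2 + 10\<close> from \<open>run_for_loop\<close>,
    where 2 is the cost of \<open>var 1\<close>.\<close>
  have inner: "run (for_loop 4 (var 1)
           (Cond missing_arc
             (Seq (Store 10 (Num 0) (Num 1))
             (Seq (Store 11 (Num 0) (var 3))
                  (Store 12 (Num 0) (var 4))))
             Skip)) s (72 * m) (\<lambda>s'. s' 3 0 = i \<and> inv (\<lambda>u v. u < Suc i) s')"
    if "inv (\<lambda>u v. u < i) s" "s 3 0 = i" "i < n" for i s
    apply (rule run_for_loop[where N = n and A = 60 and d = 0 and m = m
        and I = "\<lambda>j s. s 3 0 = i \<and> inv (\<lambda>u v. u < i \<or> u = i \<and> v < j) s"])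
    subgoal using that by (simp add: inv_upd)
    subgoal by (simp add: inv_def)
    subgoal for j s
      using \<open>i < n\<close> by (auto simp: inv_def less_Suc_eq)
    subgoal by (auto simp: inv_def less_Suc_eq)
    using m_eq by simp_all
  have exit: "ready s \<and> clean s \<and> ranked s \<and>
      (if s 10 0 = 0 then \<forall>u v. \<not> missing u v else missing (s 11 0) (s 12 0))"
    if "inv (\<lambda>u v. u < n) s" for s
    using that missing_less unfolding inv_def by (smt (verit))
  show ?thesis
    unfolding search_prog_def
    apply simp
    apply (intro conjI)
    subgoal using m by (simp add: power2_eq_square)
    apply (rule run_for_loop[where N = n and A = 72 and d = 1 and m = m
        and I = "\<lambda>j. inv (\<lambda>u v. u < j)"])
    subgoal using assms by (simp add: inv_def)
    subgoal by (simp add: inv_def)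
    subgoal for j s
      using inner[of j s] by (auto intro: run_mono simp: inv_upd)
    subgoal for s
      using exit[of s] by (cases "s 10 0 = 0") simp_all
    using m_eq m by (simp_all add: power2_eq_square)
qed

definition solved :: "memory \<Rightarrow> bool" where
  "solved s \<longleftrightarrow> (\<exists>c'. dicoloring k E {0..<n} c' \<and> (\<forall>v<n. s 6 v = Suc (c' v)))"

text \<open>The ranks serve as the distinct colors of \<open>F\<close> in
  \<open>dicoloring_of_missing_arc\<close>.\<close>

lemma inj_on_rank: "inj_on (\<lambda>v. card (F \<inter> {..<v})) F"
proof (rule linorder_inj_onI')
  fix u v
  assume uv: "u \<in> F" "v \<in> F" "u < v"
  then have "card (F \<inter> {..<u}) < card (F \<inter> {..<v})"
    using finite_F by (intro psubset_card_mono) auto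
  then show "card (F \<inter> {..<u}) \<noteq> card (F \<inter> {..<v})"
    by simp
qed

lemma rank_less: "v \<in> F \<Longrightarrow> card (F \<inter> {..<v}) < k"
  unfolding card_F[symmetric] using finite_F by (intro psubset_card_mono) auto

lemma run_rank_color_prog:
  assumes "ready s" "ranked s" "missing (s 11 0) (s 12 0)"
  shows "run rank_color_prog s (100 * m) (\<lambda>s'. ready s' \<and> solved s')"
proof -
  let ?r = "\<lambda>v. card (F \<inter> {..<v})"
  define u v where "u = s 11 0" and "v = s 12 0"
  have uv: "u \<in> F" "v \<in> F" "u \<noteq> v" "(u, v) \<notin> E" "u < n" "v < n"
    using assms(3) F_less by (auto simp: missing_def u_def v_def)
  define c' where "c' w = (if w \<in> F then if w = v then ?r u else ?r w else ?r v)" for w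
  have col: "dicoloring k E {0..<n} c'"
    unfolding c'_def using uv inj_on_rank rank_less by (intro dicoloring_of_missing_arc) auto
  show ?thesis
    unfolding rank_color_prog_def
    apply (rule run_Seq[where T = "50 * m" and U = "10"])
    \<comment> \<open>The loop still gives \<open>v\<close> its own rank; the store after it
      replaces this by the rank of \<open>u\<close>.\<close>
    apply (rule run_for_loop[where N = n and A = 30 and d = 0 and m = m
        and I = "\<lambda>j s. ready s \<and> ranked s \<and> s 11 0 = u \<and> s 12 0 = v \<and>
          (\<forall>w<j. s 6 w = Suc (if w \<in> F then ?r w else ?r v))"])
    subgoal using assms u_def v_def by simp
    subgoal by simp
    subgoal using uv by (auto simp: ranked_def less_Suc_eq)
    subgoal for s
      apply (simp add: solved_def)
      apply (rule exI[of _ c'])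
      using uv col by (auto simp: c'_def ranked_def)
    using m_eq by simp_all
qed

definition degrees :: "memory \<Rightarrow> bool" where
  "degrees s \<longleftrightarrow> (\<forall>f<n. s 8 f = card (E\<inverse> `` {f}) \<and> s 9 f = card (E `` {f}))"

lemma degrees_upd [simp]: "a \<notin> {8, 9} \<Longrightarrow> degrees (s(a := x)) = degrees s"
  by (auto simp: degrees_def)

lemma run_degree_prog:
  assumes "ready s" "clean s"
  shows "run degree_prog s (100 * m ^ 2) (\<lambda>s'. ready s' \<and> degrees s' \<and> s' 7 = (\<lambda>_. 0))"
proof -
  let ?in = "\<lambda>f. E\<inverse> `` {f}" and ?out = "\<lambda>f. E `` {f}"
  define inv where "inv i j s \<longleftrightarrow> ready s \<and> s 7 = (\<lambda>_. 0) \<and>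
      (\<forall>f<i. s 8 f = card (?in f) \<and> s 9 f = card (?out f)) \<and>
      s 8 i = card (?in i \<inter> {..<j}) \<and> s 9 i = card (?out i \<inter> {..<j}) \<and>
      (\<forall>f>i. s 8 f = 0 \<and> s 9 f = 0)" for i j and s :: memory
  have inv_upd: "inv i j (s(a := x)) = inv i j s" if "a = 3 \<or> a = 4" for i j s a x
    using that by (auto simp: inv_def)
  have sub: "?in f \<inter> {..<n} = ?in f" "?out f \<inter> {..<n} = ?out f" for f
    using arcs_in_V by auto
  have inv_next: "inv (Suc i) 0 s" if "inv i n s" for i s
    using that by (auto simp: inv_def sub less_Suc_eq)
  have inner: "run (for_loop 4 (var 1)
       (Seq (Store 8 (var 3) (Add (Cell 8 (var 3)) (entry (var 4) (var 3))))
            (Store 9 (var 3) (Add (Cell 9 (var 3)) (entry (var 3) (var 4))))))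
       s (62 * m) (\<lambda>s'. s' 3 0 = i \<and> inv (Suc i) 0 s')"
    if "inv i 0 s" "s 3 0 = i" "i < n" for i s
    apply (rule run_for_loop[where N = n and A = 50 and d = 0 and m = m
        and I = "\<lambda>j s. s 3 0 = i \<and> inv i j s"])
    subgoal using that by (simp add: inv_upd)
    subgoal by (simp add: inv_def)
    subgoal for j s
      using \<open>i < n\<close> by (auto simp: inv_def card_Int_lessThan_Suc)
    subgoal using inv_next by auto
    using m_eq by simp_all
  show ?thesis
    unfolding degree_prog_def
    apply (rule run_for_loop[where N = n and A = 62 and d = 1 and m = m
        and I = "\<lambda>j. inv j 0"])
    subgoal using assms by (simp add: inv_def clean_def)
    subgoal by (simp add: inv_def)
    subgoal for j s
      using inner[of j s] by (auto intro: run_mono simp: inv_upd)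
    subgoal by (auto simp: inv_def degrees_def)
    using m_eq by (simp_all add: power2_eq_square)
qed

lemma run_output_prog:
  assumes "ready s" "solved s"
  shows "run output_prog s (100 * m)
    (\<lambda>s'. s' 1 0 = n \<and> (\<exists>c'. dicoloring k E {0..<n} c' \<and> (\<forall>v<n. s' 0 v = c' v)))"
proof -
  obtain c' where c': "dicoloring k E {0..<n} c'" "\<forall>v<n. s 6 v = Suc (c' v)"
    using assms(2) by (auto simp: solved_def)
  show ?thesis
    unfolding output_prog_def
    \<comment> \<open>The output overwrites the input word, so the invariant keeps \<open>n\<close>
      and array 6 instead of \<open>ready\<close>.\<close>
    apply (rule run_for_loop[where N = n and A = 20 and d = 0 and m = m
        and I = "\<lambda>j s. s (Suc 0) 0 = n \<and> (\<forall>v<n. s 6 v = Suc (c' v)) \<and> (\<forall>v<j. s 0 v = c' v)"])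
    subgoal using assms(1) c'(2) by simp
    subgoal by simp
    subgoal by (auto simp: less_Suc_eq)
    subgoal using c'(1) by auto
    using m_eq by simp_all
qed

end

section \<open>The blocking procedure on the machine\<close>

locale complete_input_memory =
  input_memory n F E k c inp m + complete_fvs "{0..<n}" F E k c for n F E k c inp m
begin

lemma val_side:
  assumes "degrees s" "s 4 0 < n"
  shows "val side s = of_bool (card (E `` {s 4 0}) < card (E\<inverse> `` {s 4 0}))"
  using assms
  by (cases "card (E `` {s 4 0}) < card (E\<inverse> `` {s 4 0})") (simp_all add: side_def degrees_def)

text \<open>The term does not remove \<open>F\<close> from the neighborhood, hence the restriction
  to vertices outside \<open>F\<close>.\<close>

lemma val_in_cut [simp]:
  assumes "ready s" "degrees s" "s 3 0 < n" "s 4 0 < n" "s 3 0 \<notin> F"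
  shows "val in_cut s = of_bool (s 3 0 \<in> cut_nbhd (s 4 0))"
  using assms
  by (cases "card (E `` {s 4 0}) < card (E\<inverse> `` {s 4 0})")
    (simp_all add: in_cut_def val_side cut_nbhd_def)

lemma cost_in_cut [simp]: "cost in_cut = 41"
  by (simp add: in_cut_def side_def)

text \<open>Array 7 is addressed by the shifted colors as they stand in the input.\<close>

definition blocked :: "memory \<Rightarrow> nat set" where
  "blocked s = {i. s 7 (Suc i) \<noteq> 0}"

lemma blocked_upd [simp]: "a \<noteq> 7 \<Longrightarrow> blocked (s(a := x)) = blocked s"
  by (simp add: blocked_def)

lemma blocked_upd_insert [simp]:
  "blocked (s(7 := (s 7)(Suc i := Suc 0))) = insert i (blocked s)"
  by (auto simp: blocked_def)

lemma run_free_prog: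
  assumes "ready s" "degrees s" "s 3 0 = v" "v < n" "v \<notin> F" "s 6 v = 0"
  shows "run free_prog s (150 * m) (\<lambda>s'. ready s' \<and> degrees s' \<and> s' 3 0 = v \<and>
    s' 7 = s 7 \<and> s' 14 = s 14 \<and> (\<forall>u. u \<noteq> v \<longrightarrow> s' 6 u = s 6 u) \<and>
    (if free (blocked s) v = {} then s' 6 v = 0 else s' 6 v \<in> Suc ` c ` free (blocked s) v))"
proof -
  let ?B = "blocked s"
  have free_iff: "f \<in> free ?B v \<longleftrightarrow> f \<in> F \<and> s 7 (Suc (c f)) = 0 \<and> v \<notin> cut_nbhd f" for f
    by (auto simp: free_def blocked_def)
  show ?thesis
    unfolding free_prog_def
    apply (rule run_for_loop[where N = n and A = 100 and d = 0 and m = m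
        and I = "\<lambda>j s'. ready s' \<and> degrees s' \<and> s' 3 0 = v \<and>
          s' 7 = s 7 \<and> s' 14 = s 14 \<and> (\<forall>u. u \<noteq> v \<longrightarrow> s' 6 u = s 6 u) \<and>
          (s' 6 v = 0 \<and> (\<forall>f<j. f \<notin> free ?B v) \<or> s' 6 v \<in> Suc ` c ` free ?B v)"])
    subgoal using assms by simp
    subgoal by simp
    subgoal for j s'
      using assms(4,5) by (cases "j \<in> F") (auto simp: free_iff less_Suc_eq)
    subgoal using F_less by (auto simp: free_def)
    using m_eq by simp_all
qed

text \<open>\<open>B\<close> is a parameter because the choices of a pass are judged by the set
  blocked at its start, which need not be the current one.\<close>

definition settled :: "nat set \<Rightarrow> memory \<Rightarrow> nat \<Rightarrow> bool" where
  "settled B s v \<longleftrightarrow>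
     (if v \<in> F then s 6 v = Suc (c v)
      else if free B v = {} then s 6 v = Suc (c v) \<and> c v \<in> B
      else s 6 v \<in> Suc ` c ` free B v)"

lemma settled_upd [simp]: "a \<noteq> 6 \<Longrightarrow> settled B (s(a := x)) v = settled B s v"
  by (simp add: settled_def)

lemma run_pass_prog:
  assumes "ready s" "degrees s" "blockable (blocked s)" "s 14 0 = 0"
  shows "run pass_prog s (300 * m ^ 2) (\<lambda>s'. ready s' \<and> degrees s' \<and> blockable (blocked s') \<and>
    (s' 14 0 = 0 \<and> blocked s' = blocked s \<and> (\<forall>v<n. settled (blocked s) s' v) \<or>
     s' 14 0 = 1 \<and> blocked s \<subset> blocked s'))"
proof -
  define B where "B = blocked s"
  \<comment> \<open>Once a color has been blocked, nothing is claimed about the colors chosen in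
    this pass; only the growth of the blocked set counts.\<close>
  define inv where "inv j s \<longleftrightarrow> ready s \<and> degrees s \<and> blockable (blocked s) \<and>
      (s 14 0 = 0 \<and> blocked s = B \<and> (\<forall>v<j. settled B s v) \<or>
       s 14 0 = 1 \<and> B \<subset> blocked s)" for j and s :: memory
  have settled_cong: "settled B s' u = settled B s u" if "s' 6 u = s 6 u" for s s' u
    using that by (simp add: settled_def)
  have body: "run settle_prog s (200 * m) (\<lambda>s'. s' 3 0 = v \<and> inv (Suc v) s')"
    if s: "inv v s" "s 3 0 = v" "v < n" for v s
  proof (cases "v \<in> F")
    case True
    have "settled B (s(6 := (s 6)(v := x))) u = settled B s u" if "u < v" for u x
      using that by (intro settled_cong) auto
    then have "inv (Suc v) (s(6 := (s 6)(v := Suc (c v))))"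
      using s(1) True by (auto simp: inv_def less_Suc_eq settled_def[of _ _ v])
    then show ?thesis
      using s True m_eq by (simp add: inv_def settle_prog_def)
  next
    case False
    let ?s = "s(6 := (s 6)(v := 0))"
    have free_run: "run free_prog ?s (150 * m) (\<lambda>s'. ready s' \<and> degrees s' \<and> s' 3 0 = v \<and>
        s' 7 = s 7 \<and> s' 14 = s 14 \<and> (\<forall>u. u \<noteq> v \<longrightarrow> s' 6 u = s 6 u) \<and>
        (if free (blocked s) v = {} then s' 6 v = 0 else s' 6 v \<in> Suc ` c ` free (blocked s) v))"
      using run_free_prog[of ?s v] s False by (simp add: inv_def cong: if_cong)
    have block_run: "run block_prog s' 50 (\<lambda>s'. s' 3 0 = v \<and> inv (Suc v) s')"
      if s': "ready s'" "degrees s'" "s' 3 0 = v" "s' 7 = s 7" "s' 14 = s 14"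
        "\<forall>u. u \<noteq> v \<longrightarrow> s' 6 u = s 6 u"
        "if free (blocked s) v = {} then s' 6 v = 0 else s' 6 v \<in> Suc ` c ` free (blocked s) v"
      for s'
    proof -
      have blk: "blocked s' = blocked s"
        using s'(4) by (simp add: blocked_def)
      have old: "settled B s'' u = settled B s u" if "u < v" "\<forall>u. u \<noteq> v \<longrightarrow> s'' 6 u = s' 6 u" for u s''
        using that s'(6) by (intro settled_cong) auto
      show ?thesis
      proof (cases "free (blocked s) v = {}")
        case nonempty: False
        then have "inv (Suc v) s'"
          using s(1) s' False blk old[of _ s']
          by (auto simp: inv_def less_Suc_eq settled_def[of _ _ v])
        moreover have "s' 6 v \<noteq> 0"
          using nonempty s'(7) by auto
        ultimately show ?thesis
          using s'(3) by (simp add: block_prog_def)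
      next
        case True
        have "blockable (blocked s)"
          using s(1) by (simp add: inv_def)
        \<comment> \<open>Hence the input holds the shifted color \<open>Suc (c v)\<close> at
          \<open>v\<close>, not the mark 0.\<close>
        note nbhd = blockable_stuck_nbhd[OF this True]
        note insert = blockable_insert[OF \<open>blockable (blocked s)\<close> True]
        let ?t = "s'(6 := (s' 6)(v := Suc (c v)))"
        have t: "ready ?t" "degrees ?t" "blocked ?t = blocked s" "?t 14 = s 14" "?t 3 0 = v"
          using s' blk by auto
        have old': "settled B ?t u = settled B s u" if "u < v" for u
          using that by (intro old) auto
        show ?thesis
        proof (cases "c v \<in> blocked s")
          case blocked: True
          then have "s' 7 (Suc (c v)) \<noteq> 0"
            using s'(4) by (simp add: blocked_def)
          moreover have "inv (Suc v) ?t"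
            using s(1) t old' True blocked False
            by (auto simp: inv_def less_Suc_eq settled_def[of _ _ v])
          ultimately show ?thesis
            using s' True nbhd s(3) by (simp add: block_prog_def)
        next
          case unblocked: False
          then have "s' 7 (Suc (c v)) = 0"
            using s'(4) by (simp add: blocked_def)
          moreover have "inv (Suc v) (?t(7 := (?t 7)(Suc (c v) := Suc 0), 14 := (?t 14)(0 := Suc 0)))"
            using s(1) t insert unblocked blocked_upd_insert[of ?t "c v"]
            by (auto simp: inv_def)
          ultimately show ?thesis
            using s' True nbhd s(3) by (simp add: block_prog_def)
        qed
      qed
    qed
    have "run (Seq free_prog block_prog) ?s (150 * m + 50)
        (\<lambda>s'. s' 3 0 = v \<and> inv (Suc v) s')"
    proof (rule run_Seq)
      show "run free_prog ?s (150 * m)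
          (\<lambda>s'. run block_prog s' 50 (\<lambda>s'. s' 3 0 = v \<and> inv (Suc v) s'))"
        by (rule run_mono[OF free_run order_refl], elim conjE, rule block_run)
    qed simp
    then have "run (Seq (Store 6 (var 3) (Num 0)) (Seq free_prog block_prog)) s (150 * m + 54)
        (\<lambda>s'. s' 3 0 = v \<and> inv (Suc v) s')"
      using s by (intro run_Seq[where T = 4 and U = "150 * m + 50"]) simp_all
    then have "run (Seq (Store 6 (var 3) (Num 0)) (Seq free_prog block_prog)) s
        (200 * m - (1 + cost (in_F (var 3)))) (\<lambda>s'. s' 3 0 = v \<and> inv (Suc v) s')"
      by (rule run_mono) (use s m_eq in simp_all)
    moreover have "val (in_F (var 3)) s = 0"
      using s False by (simp add: inv_def)
    moreover have "1 + cost (in_F (var 3)) \<le> 200 * m"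
      using m_eq by simp
    ultimately show ?thesis
      unfolding settle_prog_def run_Cond by presburger
  qed
  have "run pass_prog s (300 * m ^ 2) (inv n)"
    unfolding pass_prog_def
    apply (rule run_for_loop[where N = n and A = 200 and d = 1 and m = m and I = inv])
    subgoal using assms by (auto simp: inv_def B_def settled_def)
    subgoal by (simp add: inv_def)
    subgoal for j s
      using run_mono[OF body[of j s]] by (simp add: inv_def)
    subgoal by simp
    using m_eq by (simp_all add: power2_eq_square)
  then show ?thesis
    by (rule run_mono) (auto simp: inv_def B_def)
qed

text \<open>Each pass either blocks a further color or clears the flag. Blockable sets have fewer
  than \<open>k\<close> elements, so \<open>k - card (blocked s) + s 14 0\<close> decreases from
  \<open>k + 1\<close>.\<close>

lemma run_close_prog:
  assumes "ready s" "degrees s" "s 7 = (\<lambda>_. 0)"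
  shows "run close_prog s (1000 * m ^ 3) (\<lambda>s'. ready s' \<and> solved s')"
proof -
  define inv where "inv s \<longleftrightarrow> ready s \<and> degrees s \<and> blockable (blocked s) \<and> s 14 0 \<le> 1 \<and>
      (s 14 0 = 0 \<longrightarrow> (\<forall>v<n. settled (blocked s) s v))" for s :: memory
  have finite_blocked: "finite B" "card B < k" if "blockable B" for B
  proof -
    have "B \<subset> {..<k}"
      using that by (simp add: blockable_def)
    then show "finite B" "card B < k"
      using psubset_card_mono[of "{..<k}" B] finite_subset[of B "{..<k}"] by auto
  qed
  have "k \<le> n"
    using card_F F_subset card_mono[of "{0..<n}" F] by simp
  then have "k + 2 \<le> m"
    using m_eq by simp
  have m: "1 \<le> m ^ 2" and m3: "1 \<le> m ^ 3"
    using m_eq by simp_all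
  have solved: "solved s" if s: "inv s" "s 14 0 = 0" for s
    unfolding solved_def
  proof (intro exI conjI allI impI)
    \<comment> \<open>This undoes the shift; settled entries are positive, so nothing is
      truncated.\<close>
    let ?c = "\<lambda>v. s 6 v - 1"
    have settled: "settled (blocked s) s v" if "v < n" for v
      using s that by (simp add: inv_def)
    show "dicoloring k E {0..<n} ?c"
    proof (rule dicoloring_of_closed_block)
      show "blockable (blocked s)"
        using s by (simp add: inv_def)
      show "c v \<in> blocked s" if "v \<in> {0..<n} - F" "free (blocked s) v = {}" for v
        using settled[of v] that by (simp add: settled_def)
      show "?c f = c f" if "f \<in> F" for f
        using settled[of f] that F_less by (simp add: settled_def)
      show "?c v \<in> c ` free (blocked s) v" if "v \<in> {0..<n} - F" "free (blocked s) v \<noteq> {}" for v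
        using settled[of v] that by (auto simp: settled_def)
      show "?c v = c v" if "v \<in> {0..<n} - F" "free (blocked s) v = {}" for v
        using settled[of v] that by (simp add: settled_def)
    qed
    show "s 6 v = Suc (?c v)" if "v < n" for v
      using settled[OF that] by (auto simp: settled_def split: if_splits)
  qed
  have "run (Loop (var 14) (Seq (Store 14 (Num 0) (Num 0)) pass_prog))
      (s(14 := (s 14)(0 := 1))) (400 * m ^ 3) (\<lambda>s'. ready s' \<and> solved s')"
  proof (rule run_Loop[where I = inv and V = "\<lambda>s. k - card (blocked s) + s 14 0"
        and N = "k + 1" and T = "303 * m ^ 2"])
    have "blocked (s(14 := (s 14)(0 := 1))) = {}"
      using assms(3) by (simp add: blocked_def)
    then show "inv (s(14 := (s 14)(0 := 1)))"
      using assms blockable_empty by (simp add: inv_def)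
    show "k - card (blocked (s(14 := (s 14)(0 := 1)))) + (s(14 := (s 14)(0 := 1))) 14 0 \<le> k + 1"
      by simp
  next
    fix s
    assume s: "inv s" "val (var 14) s \<noteq> 0"
    then have s14: "s 14 0 = 1"
      by (auto simp: inv_def)
    let ?s = "s(14 := (s 14)(0 := 0))"
    have "run pass_prog ?s (300 * m ^ 2) (\<lambda>s'. ready s' \<and> degrees s' \<and> blockable (blocked s') \<and>
        (s' 14 0 = 0 \<and> blocked s' = blocked ?s \<and> (\<forall>v<n. settled (blocked ?s) s' v) \<or>
         s' 14 0 = 1 \<and> blocked ?s \<subset> blocked s'))"
      using s by (intro run_pass_prog) (auto simp: inv_def)
    then have "run pass_prog ?s (303 * m ^ 2 - 3) (\<lambda>s'. inv s' \<and>
        k - card (blocked s') + s' 14 0 < k - card (blocked s) + s 14 0)"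
    proof (rule run_mono)
      show "300 * m ^ 2 \<le> 303 * m ^ 2 - 3"
        using m by simp
    next
      fix s'
      assume s': "ready s' \<and> degrees s' \<and> blockable (blocked s') \<and>
        (s' 14 0 = 0 \<and> blocked s' = blocked ?s \<and> (\<forall>v<n. settled (blocked ?s) s' v) \<or>
         s' 14 0 = 1 \<and> blocked ?s \<subset> blocked s')"
      then have "inv s'"
        by (auto simp: inv_def)
      moreover have "k - card (blocked s') < k - card (blocked s)" if "blocked s \<subset> blocked s'"
        using that s' finite_blocked psubset_card_mono[OF _ that] by (meson diff_less_mono2 less_trans)
      ultimately show "inv s' \<and> k - card (blocked s') + s' 14 0 < k - card (blocked s) + s 14 0"
        using s' s14 by (elim conjE disjE) simp_all
    qed
    then show "run (Seq (Store 14 (Num 0) (Num 0)) pass_prog) s (303 * m ^ 2)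
        (\<lambda>s'. inv s' \<and> k - card (blocked s') + s' 14 0 < k - card (blocked s) + s 14 0)"
      using m by (intro run_Seq[where T = 3 and U = "303 * m ^ 2 - 3"]) simp_all
  next
    show "ready s \<and> solved s" if "inv s" "val (var 14) s = 0" for s
      using solved that by (simp add: inv_def)
  next
    have "1 + cost (var 14) + 303 * m ^ 2 \<le> 400 * m ^ 2"
      using m unfolding cost.simps by linarith
    then have "(k + 1 + 1) * (1 + cost (var 14) + 303 * m ^ 2) \<le> m * (400 * m ^ 2)"
      using \<open>k + 2 \<le> m\<close> by (intro mult_le_mono) simp_all
    then show "(k + 1 + 1) * (1 + cost (var 14) + 303 * m ^ 2) \<le> 400 * m ^ 3"
      by (simp add: power3_eq_cube power2_eq_square)
  qed
  then have "run (Loop (var 14) (Seq (Store 14 (Num 0) (Num 0)) pass_prog))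
      (s(14 := (s 14)(0 := 1))) (1000 * m ^ 3 - 3) (\<lambda>s'. ready s' \<and> solved s')"
    by (rule run_mono) (use m3 in simp_all)
  then show ?thesis
    unfolding close_prog_def using m3
    by (intro run_Seq[where T = 3 and U = "1000 * m ^ 3 - 3"]) simp_all
qed

end

context input_memory
begin

text \<open>The degree bound and the given coloring enter through \<open>complete\<close>, which is
  invoked in the branch where the search finds no missing arc.\<close>

lemma run_coloring_prog:
  assumes "s 0 = inp" "clean s"
    and complete: "(\<And>u v. \<not> missing u v) \<Longrightarrow> complete_fvs {0..<n} F E k c"
  shows "run coloring_prog s (2000 * m ^ 3)
    (\<lambda>s'. s' 1 0 = n \<and> (\<exists>c'. dicoloring k E {0..<n} c' \<and> (\<forall>v<n. s' 0 v = c' v)))"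
    (is "run _ _ _ ?Q")
proof -
  have m: "1 \<le> m" "m \<le> m ^ 2" "m ^ 2 \<le> m ^ 3" "m \<le> m ^ 3"
    using m_eq by (auto simp: power2_eq_square power3_eq_cube)
  have extend: "run (Cond (var 10) rank_color_prog (Seq degree_prog close_prog)) s (1200 * m ^ 3)
      (\<lambda>s'. run output_prog s' (100 * m) ?Q)"
    if s: "ready s" "clean s" "ranked s"
      "if s 10 0 = 0 then \<forall>u v. \<not> missing u v else missing (s 11 0) (s 12 0)" for s
  proof -
    have "run (if val (var 10) s \<noteq> 0 then rank_color_prog else Seq degree_prog close_prog) s
        (1100 * m ^ 3) (\<lambda>s'. ready s' \<and> solved s')"
    proof (cases "s 10 0 = 0")
      case True
      then interpret complete_input_memory n F E k c inp m
        using s(4) complete input_memory_axioms by (simp add: complete_input_memory_def)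
      have "run (Seq degree_prog close_prog) s (1100 * m ^ 3) (\<lambda>s'. ready s' \<and> solved s')"
      proof (rule run_Seq)
        show "run degree_prog s (100 * m ^ 2)
            (\<lambda>s'. run close_prog s' (1000 * m ^ 3) (\<lambda>s'. ready s' \<and> solved s'))"
          by (rule run_mono[OF run_degree_prog[OF s(1,2)] order_refl]) (simp add: run_close_prog)
        show "100 * m ^ 2 + 1000 * m ^ 3 \<le> 1100 * m ^ 3"
          using m(3) by linarith
      qed
      then show ?thesis
        using True by simp
    next
      case False
      then have "run rank_color_prog s (1100 * m ^ 3) (\<lambda>s'. ready s' \<and> solved s')"
        using s m(4) by (intro run_mono[OF run_rank_color_prog]) auto
      then show ?thesis
        using False by simp
    qed
    then have "run (if val (var 10) s \<noteq> 0 then rank_color_prog else Seq degree_prog close_prog) s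
        (1200 * m ^ 3 - (1 + cost (var 10))) (\<lambda>s'. run output_prog s' (100 * m) ?Q)"
    proof (rule run_mono)
      show "1100 * m ^ 3 \<le> 1200 * m ^ 3 - (1 + cost (var 10))"
        using m(1,4) unfolding cost.simps by linarith
      show "run output_prog s' (100 * m) ?Q" if "ready s' \<and> solved s'" for s'
        using that by (elim conjE) (rule run_output_prog)
    qed
    moreover have "1 + cost (var 10) \<le> 1200 * m ^ 3"
      using m(1,4) unfolding cost.simps by linarith
    ultimately show ?thesis
      unfolding run_Cond by blast
  qed
  have "run (Seq (Cond (var 10) rank_color_prog (Seq degree_prog close_prog)) output_prog) s
      (1300 * m ^ 3) ?Q"
    if "ready s" "clean s" "ranked s"
      "if s 10 0 = 0 then \<forall>u v. \<not> missing u v else missing (s 11 0) (s 12 0)" for s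
    by (rule run_Seq[OF extend[OF that]]) (use m(4) in linarith)
  then have "run (Seq search_prog
      (Seq (Cond (var 10) rank_color_prog (Seq degree_prog close_prog)) output_prog)) s
      (1400 * m ^ 3) ?Q"
    if "ready s" "clean s" "ranked s" for s
    by (intro run_Seq[OF run_mono[OF run_search_prog[OF that] order_refl]]) (use m(3) in auto)
  then have "run (Seq rank_prog (Seq search_prog
      (Seq (Cond (var 10) rank_color_prog (Seq degree_prog close_prog)) output_prog))) s
      (1500 * m ^ 3) ?Q"
    if "ready s" "clean s" for s
    by (intro run_Seq[OF run_mono[OF run_rank_prog[OF that] order_refl]]) (use m(4) in auto)
  then show ?thesis
    unfolding coloring_prog_def
    by (intro run_Seq[OF run_mono[OF run_rows_prog[OF assms(1,2)] order_refl]]) (use m(4) in auto)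
qed

end

section \<open>The encoding as memory contents, and the main result\<close>

lemma length_concat_rows:
  "length (concat (map (\<lambda>u. map (g u) [0..<n]) [0..<j])) = j * n"
  by (induction j) auto

lemma nth_concat_rows:
  assumes "u < j" "v < n"
  shows "concat (map (\<lambda>u. map (g u) [0..<n]) [0..<j]) ! (u * n + v) = g u v"
  using assms(1)
proof (induction j)
  case (Suc j)
  show ?case
  proof (cases "u = j")
    case True
    then show ?thesis
      using assms(2) by (simp add: nth_append length_concat_rows)
  next
    case False
    then have less: "u < j"
      using Suc.prems by simp
    then have "Suc u * n \<le> j * n"
      by (intro mult_le_mono) auto
    then have "u * n + v < j * n"
      using assms(2) by simp
    then show ?thesis
      using Suc.IH[OF less] by (simp add: nth_append length_concat_rows)
  qed
qed simp

lemma length_encode_instance: "length (encode_instance (n, k, D, F, c)) = 2 + n * n + n + n"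
  by (simp add: length_concat_rows)

lemma nth_encode_instance:
  fixes D :: "(nat, 'b) pre_digraph" and n k :: nat and F :: "nat set" and c :: "nat \<Rightarrow> nat"
  defines "xs \<equiv> encode_instance (n, k, D, F, c)"
  shows "xs ! 0 = n"
    and "u < n \<Longrightarrow> v < n \<Longrightarrow> xs ! (2 + u * n + v) = of_bool (u \<rightarrow>\<^bsub>D\<^esub> v)"
    and "v < n \<Longrightarrow> xs ! (2 + n * n + v) = of_bool (v \<in> F)"
    and "v < n \<Longrightarrow> xs ! (2 + Suc n * n + v) = (if v \<in> closed_nbhd D F then Suc (c v) else 0)"
proof -
  define M where
    "M = concat (map (\<lambda>u. map (\<lambda>v. if u \<rightarrow>\<^bsub>D\<^esub> v then 1 else (0 :: nat)) [0..<n]) [0..<n])"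
  define fs where "fs = map (\<lambda>v. if v \<in> F then 1 else (0 :: nat)) [0..<n]"
  define cs where "cs = map (\<lambda>v. if v \<in> closed_nbhd D F then Suc (c v) else 0) [0..<n]"
  have xs: "xs = [n, k] @ M @ fs @ cs"
    by (simp add: xs_def M_def fs_def cs_def)
  have len: "length M = n * n" "length fs = n"
    by (simp_all add: M_def fs_def length_concat_rows)
  show "xs ! 0 = n"
    by (simp add: xs)
  show "xs ! (2 + u * n + v) = of_bool (u \<rightarrow>\<^bsub>D\<^esub> v)" if "u < n" "v < n"
  proof -
    have "Suc u * n \<le> n * n"
      using that by (intro mult_le_mono) auto
    then have "u * n + v < n * n"
      using that by simp
    then show ?thesis
      using that by (simp add: xs nth_append len) (simp add: M_def nth_concat_rows)
  qed
  show "xs ! (2 + n * n + v) = of_bool (v \<in> F)" if "v < n"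
    using that by (simp add: xs nth_append len) (simp add: fs_def)
  show "xs ! (2 + Suc n * n + v) = (if v \<in> closed_nbhd D F then Suc (c v) else 0)" if "v < n"
    using that by (simp add: xs nth_append len) (simp add: cs_def)
qed

lemma input_memory_load:
  fixes G :: "(nat, 'b) pre_digraph"
  assumes "digraph G" and "verts G = {0..<n}" "feedback_vertex_set G F" "card F = k"
  shows "input_memory n F (arcs_ends G) k c (load (encode_instance (n, k, G, F, c)) 0) (n + 3)"
proof -
  interpret digraph G by fact
  let ?xs = "encode_instance (n, k, G, F, c)"
  interpret fvs_digraph "{0..<n}" F "arcs_ends G" k
    using fvs_digraphI[OF assms(3,4)] assms(2) by simp
  have load: "load ?xs 0 i = ?xs ! i" if "i < 2 + n * n + n + n" for i
    using that unfolding load_def length_encode_instance by simp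
  show ?thesis
  proof
    show "load ?xs 0 0 = n"
      using load[of 0] nth_encode_instance(1)[of n k G F c] by simp
    show "load ?xs 0 (2 + u * n + v) = of_bool (u \<rightarrow>\<^bsub>G\<^esub> v)" if "u < n" "v < n" for u v
    proof -
      have "Suc u * n \<le> n * n"
        using that by (intro mult_le_mono) auto
      then have "2 + u * n + v < 2 + n * n + n + n"
        using that by simp
      then have "load ?xs 0 (2 + u * n + v) = ?xs ! (2 + u * n + v)"
        by (rule load)
      also have "\<dots> = of_bool (u \<rightarrow>\<^bsub>G\<^esub> v)"
        using that by (rule nth_encode_instance(2))
      finally show ?thesis .
    qed
    show "load ?xs 0 (2 + n * n + v) = of_bool (v \<in> F)" if "v < n" for v
      using load[of "2 + n * n + v"] nth_encode_instance(3)[OF that, of k G F c] that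
      by simp
    show "load ?xs 0 (2 + Suc n * n + v) =
        (if v \<in> F \<union> arcs_ends G `` F \<union> (arcs_ends G)\<inverse> `` F then Suc (c v) else 0)"
      if "v < n" for v
      using load[of "2 + Suc n * n + v"] nth_encode_instance(4)[OF that, of k G F c] that
      unfolding closed_nbhd_eq by simp
  qed simp
qed

lemma run_coloring_prog_load:
  fixes G :: "(nat, 'b) pre_digraph"
  assumes "digraph G" and "verts G = {0..<n}" "feedback_vertex_set G F" "card F = k" "k \<ge> 1"
    and "max_degree G \<le> 4 * k - 3" "is_coloring k (G \<restriction> closed_nbhd G F) c"
  shows "run coloring_prog (load (encode_instance (n, k, G, F, c))) (2000 * (n + 3) ^ 3)
    (\<lambda>s. is_solution (n, k, G, F, c) (result s))"
proof -
  interpret digraph G by fact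
  let ?s = "load (encode_instance (n, k, G, F, c))"
  interpret input_memory n F "arcs_ends G" k c "?s 0" "n + 3"
    using assms(1-4) by (rule input_memory_load)
  have "clean ?s"
    by (auto simp: clean_def load_def)
  moreover have "complete_fvs {0..<n} F (arcs_ends G) k c" if "\<And>u v. \<not> missing u v"
    using complete_fvsI[OF assms(3-7)] assms(2) that by (auto simp: missing_def)
  ultimately have "run coloring_prog ?s (2000 * (n + 3) ^ 3) (\<lambda>s'. s' 1 0 = n \<and>
      (\<exists>c'. dicoloring k (arcs_ends G) {0..<n} c' \<and> (\<forall>v<n. s' 0 v = c' v)))"
    by (intro run_coloring_prog) auto
  then show ?thesis
  proof (rule run_mono)
    fix s' :: memory
    assume "s' 1 0 = n \<and>
      (\<exists>c'. dicoloring k (arcs_ends G) {0..<n} c' \<and> (\<forall>v<n. s' 0 v = c' v))"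
    then obtain c' where "s' 1 0 = n" "is_coloring k G c'" "\<forall>v<n. s' 0 v = c' v"
      using assms(2) by (auto simp: is_coloring_iff)
    then show "is_solution (n, k, G, F, c) (result s')"
      by (auto simp: result_def intro!: exI[of _ c'])
  qed simp
qed

theorem theorem5:
  shows "(\<forall>(k :: nat) (D :: ('a, 'b) pre_digraph) F.
      k \<ge> 1 \<and> digraph D \<and> feedback_vertex_set D F \<and> card F = k \<and> max_degree D \<le> 4 * k - 3 \<longrightarrow>
      (colorable k D \<longleftrightarrow> colorable k (D \<restriction> closed_nbhd D F)))
    \<and>
    polytime_solvable
      {(n, k, D :: (nat, nat) pre_digraph, F, c).
        k \<ge> 1 \<and> digraph D \<and> verts D = {0..<n} \<and>
        feedback_vertex_set D F \<and> card F = k \<and> max_degree D \<le> 4 * k - 3 \<and>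
        is_coloring k (D \<restriction> closed_nbhd D F) c}
      encode_instance
      is_solution"
    (is "?colorable \<and> polytime_solvable ?I encode_instance is_solution")
proof
  show ?colorable
    using digraph.colorable_iff_closed_nbhd by blast
  \<comment> \<open>The word has length \<open>n * n + 2 * n + 2\<close>, so its successor is at
    least \<open>n + 3\<close>.\<close>
  let ?p = "smult 2000 ([:1, 1:] ^ 3) :: nat poly"
  have "\<exists>t s. exec coloring_prog (load (encode_instance x)) t s \<and>
      t \<le> poly ?p (length (encode_instance x)) \<and> is_solution x (result s)" if "x \<in> ?I" for x
  proof -
    obtain n k D F c where x: "x = (n, k, D, F, c)"
      by (cases x)
    have "run coloring_prog (load (encode_instance x)) (2000 * (n + 3) ^ 3)
        (\<lambda>s. is_solution x (result s))"
      using that unfolding x by (intro run_coloring_prog_load) auto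
    moreover have "2000 * (n + 3) ^ 3 \<le> poly ?p (length (encode_instance x))"
      unfolding x length_encode_instance
      by (simp add: poly_power power_mono)
    ultimately show ?thesis
      unfolding run_def by (meson le_trans)
  qed
  then show "polytime_solvable ?I encode_instance is_solution"
    unfolding polytime_solvable_def by blast
qed

end
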